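(* Let $(W,S)$ be an arbitrary Coxeter system with set of reflections $T$, and let $t,t'\in T$ be two distinct reflections. Then there is a unique maximal (with respect to inclusion) dihedral reflection subgroup $W(t,t')$ of $W$ among those containing $t$ and $t'$. It is given by $W(t,t')=W_w$, where $w=tt'$ and $W_w=\langle R_w\rangle$ with $$R_w=\{r\in T \mid \text{there exists } r'\in T \text{ such that } w=rr'\}.$$
   Context: $(W,S)$ is a Coxeter system, where $S$ is not assumed to be finite. $T:=\bigcup_{w\in W} wSw^{-1}$ is its set of reflections, and $\ell$ is the length function on $W$ with respect to $S$. A reflection subgroup of $W$ is a subgroup $W'$ generated by a subset of $T$. By a theorem of Dyer and Deodhar, every reflection subgroup $W'$ is a Coxeter group with canonical set of simple generators $\chi(W')=\{t\in T\cap W' \mid \{r\in T : \ell(rt)<\ell(t)\}\cap W'=\{t\}\}$, and the set of reflections of the Coxeter system $(W',\chi(W'))$ is $W'\cap T$. The rank of $W'$ is $|\chi(W')|$. A reflection subgroup is called dihedral if it has rank two (it may be finite or infinite). *)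

theory Defs
  imports "HOL-Algebra.Generated_Groups"
begin

(* A group word over S is a list of signed letters: (s, True) stands for s and (s, False) for
   the formal inverse of s. *)

type_synonym 'a gword = "('a \<times> bool) list"

definition gwords :: "'a set \<Rightarrow> 'a gword set" where
  "gwords S = lists (S \<times> UNIV)"

definition gword_eval :: "('a, 'b) monoid_scheme \<Rightarrow> 'a gword \<Rightarrow> 'a" where
  "gword_eval G u =
     foldr (\<lambda>(s, b) x. (if b then s else inv\<^bsub>G\<^esub> s) \<otimes>\<^bsub>G\<^esub> x) u \<one>\<^bsub>G\<^esub>"

(* The congruence on group words over S whose quotient is the group presented by S and the
   relators R, i.e. the free group on S modulo the normal closure of R. *)

inductive presentation_cong :: "'a set \<Rightarrow> 'a gword set \<Rightarrow> 'a gword \<Rightarrow> 'a gword \<Rightarrow> bool"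
  for S R where
  refl: "u \<in> gwords S \<Longrightarrow> presentation_cong S R u u"
| sym: "presentation_cong S R u v \<Longrightarrow> presentation_cong S R v u"
| trans: "presentation_cong S R u v \<Longrightarrow> presentation_cong S R v w \<Longrightarrow> presentation_cong S R u w"
| append: "presentation_cong S R u u' \<Longrightarrow> presentation_cong S R v v' \<Longrightarrow>
    presentation_cong S R (u @ v) (u' @ v')"
| cancel: "s \<in> S \<Longrightarrow> presentation_cong S R [(s, b), (s, \<not> b)] []"
| relator: "r \<in> R \<Longrightarrow> presentation_cong S R r []"

(* The inclusion of S into G induces an isomorphism from the group presented by S and R to G. *)

definition presented_by :: "('a, 'b) monoid_scheme \<Rightarrow> 'a set \<Rightarrow> 'a gword set \<Rightarrow> bool" where
  "presented_by G S R \<longleftrightarrow>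
     S \<subseteq> carrier G \<and> R \<subseteq> gwords S \<and> generate G S = carrier G \<and>
     (\<forall>u \<in> gwords S. gword_eval G u = \<one>\<^bsub>G\<^esub> \<longleftrightarrow> presentation_cong S R u [])"

(* The value 0 encodes the entry infinity of a Coxeter matrix: the relator (st)^0 is the empty
   word and so imposes no relation. *)

definition coxeter_matrix :: "'a set \<Rightarrow> ('a \<Rightarrow> 'a \<Rightarrow> nat) \<Rightarrow> bool" where
  "coxeter_matrix S m \<longleftrightarrow>
     (\<forall>s\<in>S. \<forall>t\<in>S. m s t = m t s \<and> (m s t = 1 \<longleftrightarrow> s = t))"

definition coxeter_relators :: "'a set \<Rightarrow> ('a \<Rightarrow> 'a \<Rightarrow> nat) \<Rightarrow> 'a gword set" where
  "coxeter_relators S m =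
     {concat (replicate (m s t) [(s, True), (t, True)]) | s t. s \<in> S \<and> t \<in> S}"

locale coxeter_system = group G for G (structure) and S +
  assumes coxeter_presentation:
    "\<exists>m. coxeter_matrix S m \<and> presented_by G S (coxeter_relators S m)"

(* Letters in the words below are unsigned, the elements of S being involutions. *)

definition coxeter_length :: "('a, 'b) monoid_scheme \<Rightarrow> 'a set \<Rightarrow> 'a \<Rightarrow> nat" where
  "coxeter_length G S w =
     (LEAST n. \<exists>ss \<in> lists S. length ss = n \<and> foldr (\<otimes>\<^bsub>G\<^esub>) ss \<one>\<^bsub>G\<^esub> = w)"

definition reflections :: "('a, 'b) monoid_scheme \<Rightarrow> 'a set \<Rightarrow> 'a set" where
  "reflections G S = {w \<otimes>\<^bsub>G\<^esub> s \<otimes>\<^bsub>G\<^esub> inv\<^bsub>G\<^esub> w | w s. w \<in> carrier G \<and> s \<in> S}"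

definition reflection_subgroup :: "('a, 'b) monoid_scheme \<Rightarrow> 'a set \<Rightarrow> 'a set \<Rightarrow> bool" where
  "reflection_subgroup G S H \<longleftrightarrow> (\<exists>A \<subseteq> reflections G S. H = generate G A)"

definition canonical_generators :: "('a, 'b) monoid_scheme \<Rightarrow> 'a set \<Rightarrow> 'a set \<Rightarrow> 'a set" where
  "canonical_generators G S H =
     {t \<in> reflections G S \<inter> H.
        {r \<in> reflections G S. coxeter_length G S (r \<otimes>\<^bsub>G\<^esub> t) < coxeter_length G S t} \<inter> H = {t}}"

definition dihedral_reflection_subgroup ::
    "('a, 'b) monoid_scheme \<Rightarrow> 'a set \<Rightarrow> 'a set \<Rightarrow> bool" where
  "dihedral_reflection_subgroup G S H \<longleftrightarrow>
     reflection_subgroup G S H \<and> card (canonical_generators G S H) = 2"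

definition maximal_dihedral_containing ::
    "('a, 'b) monoid_scheme \<Rightarrow> 'a set \<Rightarrow> 'a \<Rightarrow> 'a \<Rightarrow> 'a set \<Rightarrow> bool" where
  "maximal_dihedral_containing G S t t' H \<longleftrightarrow>
     dihedral_reflection_subgroup G S H \<and> t \<in> H \<and> t' \<in> H \<and>
     (\<forall>K. dihedral_reflection_subgroup G S K \<and> t \<in> K \<and> t' \<in> K \<and> H \<subseteq> K \<longrightarrow> K = H)"

definition maximal_dihedral ::
    "('a, 'b) monoid_scheme \<Rightarrow> 'a set \<Rightarrow> 'a \<Rightarrow> 'a \<Rightarrow> 'a set" where
  "maximal_dihedral G S t t' = (THE H. maximal_dihedral_containing G S t t' H)"

(* The set R_w and the subgroup W_w that it generates. *)

definition reflection_divisors :: "('a, 'b) monoid_scheme \<Rightarrow> 'a set \<Rightarrow> 'a \<Rightarrow> 'a set" where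
  "reflection_divisors G S w =
     {r \<in> reflections G S. \<exists>r' \<in> reflections G S. w = r \<otimes>\<^bsub>G\<^esub> r'}"

definition divisor_subgroup :: "('a, 'b) monoid_scheme \<Rightarrow> 'a set \<Rightarrow> 'a \<Rightarrow> 'a set" where
  "divisor_subgroup G S w = generate G (reflection_divisors G S w)"

end

theory Submission
  imports Defs Complex_Main
begin

text \<open>\<open>W\<close> acts on a space in which both the simple roots (as linear functionals) and the simple
  coroots (as vectors) are linearly independent, and a root is nonnegative or nonpositive according
  to descents of the length function. A product \<open>w = t t'\<close> of two distinct reflections fixes exactly
  the common kernel of the two roots, so the roots of all reflections in \<open>W\<^sub>w\<close> lie in the plane
  spanned by the roots of \<open>t\<close> and \<open>t'\<close>. Distinct canonical generators of a reflection subgroup have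
  positive roots at a non-acute angle, and a plane contains at most two such roots; hence \<open>W\<^sub>w\<close> is
  dihedral. Conversely, in a dihedral reflection subgroup containing \<open>t\<close> and \<open>t'\<close> the product of
  three reflections is a reflection, so each of its reflections \<open>r\<close> satisfies \<open>w = r (r w)\<close> with
  \<open>r w\<close> a reflection.\<close>

section \<open>Words and lengths\<close>

text \<open>Two demands shape the space. Sign arguments need independent simple roots, and
  identifying the fixed vectors of a product of two reflections needs coroots that determine their
  reflections. A degenerate Cartan matrix spoils either classical model: for the infinite dihedral
  group, the two simple roots are negatives of each other as functionals on the span of the coroots,
  and so are the two coroots in the dual model. Doubling the coordinates serves both demands at
  once. The fixed space of \<open>w\<close> is what all factorizations of \<open>w\<close> into two
  reflections share; this is why a set defined by factorizations of \<open>w\<close> ends up in one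
  plane of roots. The outcome is stronger than maximality: the divisor subgroup contains every
  dihedral reflection subgroup through \<open>t\<close> and \<open>t'\<close>, so existence and
  uniqueness of the maximal one follow together.\<close>

fun alt_word :: "nat \<Rightarrow> 'a \<Rightarrow> 'a \<Rightarrow> 'a list" where
  "alt_word 0 p q = []"
| "alt_word (Suc k) p q = alt_word k q p @ [p]"

lemma length_alt_word [simp]: "length (alt_word k p q) = k"
  by (induction k arbitrary: p q) auto

lemma set_alt_word: "set (alt_word k p q) \<subseteq> {p, q}"
  by (induction k arbitrary: p q) auto

lemma alt_word_split: "\<exists>us. set us \<subseteq> {p, q} \<and> length us = i \<and> alt_word (i + j) p q = us @ alt_word j p q"
proof (induction j arbitrary: p q)
  case 0
  show ?case using set_alt_word[of i p q] by auto
next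
  case (Suc j)
  from Suc.IH[of q p] obtain us where "set us \<subseteq> {q, p}" "length us = i"
    "alt_word (i + j) q p = us @ alt_word j q p" by blast
  then show ?case by auto
qed

lemma alt_word_double: "alt_word (2 * k) p q = concat (replicate k [q, p])"
proof (induction k)
  case (Suc k)
  have "concat (replicate (Suc k) [q, p]) = concat (replicate k [q, p]) @ [q, p]"
    by (induction k) auto
  with Suc show ?case by simp
qed simp

text \<open>The recursion fixes the last letter, so longer words grow on the left and parity decides
  the new first letter.\<close>

lemma alt_word_Cons: "alt_word (Suc k) p q = (if even k then p else q) # alt_word k p q"
  by (induction k arbitrary: p q) auto

text \<open>One matrix is fixed because the Cartan matrix is read off from it; a Coxeter system only
  asserts that such a matrix exists.\<close>

locale coxeter_matrix_system = group G for G (structure) and S :: "'a set" and m :: "'a \<Rightarrow> 'a \<Rightarrow> nat" +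
  assumes matrix: "coxeter_matrix S m"
    and presentation: "presented_by G S (coxeter_relators S m)"
begin

definition word :: "'a list \<Rightarrow> 'a" where
  "word ss = foldr (\<otimes>) ss \<one>"

lemma word_simps [simp]: "word [] = \<one>" "word (s # ss) = s \<otimes> word ss"
  by (auto simp: word_def)

abbreviation len :: "'a \<Rightarrow> nat" where
  "len \<equiv> coxeter_length G S"

abbreviation T :: "'a set" where
  "T \<equiv> reflections G S"

lemma S_carrier: "s \<in> S \<Longrightarrow> s \<in> carrier G"
  using presentation unfolding presented_by_def by auto

lemma word_closed [simp]: "set ss \<subseteq> carrier G \<Longrightarrow> word ss \<in> carrier G"
  by (induction ss) auto

lemma S_words: "set ss \<subseteq> S \<Longrightarrow> set ss \<subseteq> carrier G"
  using S_carrier by auto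

lemma word_S_closed: "set ss \<subseteq> S \<Longrightarrow> word ss \<in> carrier G"
  using S_words by simp

lemma word_append: "set xs \<subseteq> carrier G \<Longrightarrow> set ys \<subseteq> carrier G \<Longrightarrow> word (xs @ ys) = word xs \<otimes> word ys"
  by (induction xs) (auto simp: m_assoc)

lemma gword_eval_positive: "gword_eval G (map (\<lambda>s. (s, True)) ss) = word ss"
  unfolding gword_eval_def by (induction ss) auto

lemma word_eq_one_iff:
  assumes "set ss \<subseteq> S"
  shows "word ss = \<one> \<longleftrightarrow> presentation_cong S (coxeter_relators S m) (map (\<lambda>s. (s, True)) ss) []"
proof -
  have "map (\<lambda>s. (s, True)) ss \<in> gwords S"
    using assms unfolding gwords_def by auto
  with presentation show ?thesis
    unfolding presented_by_def by (metis gword_eval_positive)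
qed

lemma word_relator:
  assumes "s \<in> S" "t \<in> S"
  shows "word (concat (replicate (m s t) [s, t])) = \<one>"
proof -
  have map_eq: "map (\<lambda>s. (s, True)) (concat (replicate k [s, t]))
      = concat (replicate k [(s, True), (t, True)])" for k
    by (induction k) auto
  have "concat (replicate (m s t) [(s, True), (t, True)]) \<in> coxeter_relators S m"
    using assms unfolding coxeter_relators_def by auto
  moreover have "set (concat (replicate k [s, t])) \<subseteq> S" for k
    using assms by (induction k) auto
  ultimately show ?thesis
    using word_eq_one_iff[of "concat (replicate (m s t) [s, t])"]
    by (metis map_eq presentation_cong.relator)
qed

lemma m_sym: "s \<in> S \<Longrightarrow> t \<in> S \<Longrightarrow> m s t = m t s"
  and m_eq_one_iff: "s \<in> S \<Longrightarrow> t \<in> S \<Longrightarrow> m s t = 1 \<longleftrightarrow> s = t"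
  using matrix unfolding coxeter_matrix_def by blast+

lemma S_square: "s \<in> S \<Longrightarrow> s \<otimes> s = \<one>"
  using word_relator[of s s] m_eq_one_iff[of s s] S_carrier[of s] by simp

lemma inv_cancel [simp]:
  assumes "g \<in> carrier G" "x \<in> carrier G"
  shows "inv g \<otimes> (g \<otimes> x) = x" "g \<otimes> (inv g \<otimes> x) = x"
  using assms by (simp_all add: m_assoc[symmetric])

lemma S_cancel: "s \<in> S \<Longrightarrow> x \<in> carrier G \<Longrightarrow> s \<otimes> (s \<otimes> x) = x"
  using S_square[of s] S_carrier[of s] by (simp add: m_assoc[symmetric])

lemma S_inv: "s \<in> S \<Longrightarrow> inv s = s"
  using S_square S_carrier by (metis inv_equality)

lemma inv_word: "set ss \<subseteq> S \<Longrightarrow> inv (word ss) = word (rev ss)"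
proof (induction ss)
  case (Cons s ss)
  then have "set (rev ss) \<subseteq> carrier G" "set ss \<subseteq> carrier G" "s \<in> carrier G"
    using S_words S_carrier by auto
  then show ?case
    using Cons by (simp add: word_append inv_mult_group S_inv)
qed simp

lemma carrier_word:
  assumes "g \<in> carrier G"
  obtains ss where "set ss \<subseteq> S" "word ss = g"
proof -
  have "g \<in> generate G S"
    using assms presentation unfolding presented_by_def by auto
  then have "\<exists>ss. set ss \<subseteq> S \<and> word ss = g"
  proof (induction rule: generate.induct)
    case one
    show ?case by (rule exI[of _ "[]"]) auto
  next
    case (incl h)
    then show ?case by (intro exI[of _ "[h]"]) (auto simp: S_carrier)
  next
    case (inv h)
    then show ?case by (intro exI[of _ "[h]"]) (auto simp: S_carrier S_inv)
  next
    case (eng h1 h2)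
    then obtain xs ys where "set xs \<subseteq> S" "word xs = h1" "set ys \<subseteq> S" "word ys = h2" by blast
    then show ?case
      by (intro exI[of _ "xs @ ys"]) (auto simp: S_words word_append)
  qed
  then show ?thesis using that by blast
qed

lemma len_le: "set ss \<subseteq> S \<Longrightarrow> len (word ss) \<le> length ss"
  unfolding coxeter_length_def word_def by (rule Least_le) auto

lemma reduced_word:
  assumes "g \<in> carrier G"
  obtains ss where "set ss \<subseteq> S" "word ss = g" "length ss = len g"
proof -
  obtain us where "set us \<subseteq> S" "word us = g"
    using carrier_word assms by blast
  then have "us \<in> lists S" "word us = g" by auto
  then have "\<exists>n. \<exists>ss\<in>lists S. length ss = n \<and> word ss = g" by blast
  then have "\<exists>ss\<in>lists S. length ss = len g \<and> word ss = g"
    unfolding coxeter_length_def word_def by (rule LeastI_ex)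
  then show ?thesis using that by (metis in_lists_conv_set subsetI)
qed

lemma len_mult_le:
  assumes "g \<in> carrier G" "h \<in> carrier G"
  shows "len (g \<otimes> h) \<le> len g + len h"
proof -
  obtain xs where xs: "set xs \<subseteq> S" "word xs = g" "length xs = len g"
    using reduced_word assms(1) by blast
  obtain ys where ys: "set ys \<subseteq> S" "word ys = h" "length ys = len h"
    using reduced_word assms(2) by blast
  have "word (xs @ ys) = g \<otimes> h"
    using xs ys S_words by (simp add: word_append)
  then show ?thesis
    using len_le[of "xs @ ys"] xs ys by auto
qed

lemma len_one [simp]: "len \<one> = 0"
  using len_le[of "[]"] by simp

lemma len_generator: "s \<in> S \<Longrightarrow> len s \<le> 1"
  using len_le[of "[s]"] S_carrier by simp

lemma len_inv: 
  assumes "g \<in> carrier G" shows "len (inv g) = len g"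
proof -
  have *: "len (inv g) \<le> len g" if g: "g \<in> carrier G" for g
  proof -
    obtain xs where xs: "set xs \<subseteq> S" "word xs = g" "length xs = len g"
      using reduced_word g by blast
    then show ?thesis using len_le[of "rev xs"] inv_word[of xs] by simp
  qed
  show ?thesis using *[of g] *[of "inv g"] assms by simp
qed

lemma descent_exists:
  assumes "g \<in> carrier G" "g \<noteq> \<one>"
  obtains s where "s \<in> S" "len (g \<otimes> s) < len g"
proof -
  obtain ss where ss: "set ss \<subseteq> S" "word ss = g" "length ss = len g"
    using reduced_word assms(1) by blast
  have "ss \<noteq> []" using ss(2) assms(2) by auto
  then obtain us s where us: "ss = us @ [s]" by (metis rev_exhaust)
  then have mem: "set us \<subseteq> S" "s \<in> S" using ss(1) by auto
  have "g = word us \<otimes> s"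
    using ss(2) mem S_carrier[of s] S_words[of us] unfolding us
    by (subst (asm) word_append) auto
  then have "g \<otimes> s = word us"
    using mem S_carrier[of s] S_words[of us] by (simp add: m_assoc S_square)
  then have "len (g \<otimes> s) \<le> length us" using len_le[of us] mem by simp
  then show ?thesis using that mem(2) us ss(3) by force
qed

lemma alt_word_one:
  assumes "s \<in> S" "t \<in> S"
  shows "word (alt_word (2 * m s t) t s) = \<one>"
  using assms word_relator unfolding alt_word_double by blast

text \<open>The alternating word of length \<open>2 * m s t\<close> is trivial, so its last
  \<open>m s t + 1\<close> letters are the inverse of its first \<open>m s t - 1\<close>. Replacing
  such a suffix by the shorter word saves two letters.\<close>

lemma alt_word_short:
  assumes st: "s \<in> S" "t \<in> S" and "m s t > 0" "m s t < k"
  obtains us where "set us \<subseteq> S" "length us \<le> k - 2" "word us = word (alt_word k s t)"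
proof -
  let ?n = "m s t"
  have sym: "m t s = ?n" using m_sym st by metis
  obtain xs where xs: "set xs \<subseteq> {s, t}" "length xs = ?n - 1"
      "alt_word (?n - 1 + Suc ?n) s t = xs @ alt_word (Suc ?n) s t"
    using alt_word_split[of s t "?n - 1" "Suc ?n"] by blast
  have n2: "?n - 1 + Suc ?n = 2 * m t s" using assms(3) sym by simp
  have xsS: "set xs \<subseteq> S" and altS: "set (alt_word j s t) \<subseteq> S" for j
    using xs(1) st set_alt_word[of j s t] by auto
  have "word xs \<otimes> word (alt_word (Suc ?n) s t) = word (xs @ alt_word (Suc ?n) s t)"
    using S_words[OF xsS] S_words[OF altS] by (simp only: word_append)
  also have "\<dots> = \<one>"
    using alt_word_one[of t s] st xs(3) n2 by metis
  finally have "word (alt_word (Suc ?n) s t) = inv (word xs)"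
    using S_words[OF xsS] S_words[OF altS]
    by (metis inv_equality inv_inv word_closed)
  then have e1: "word (alt_word (Suc ?n) s t) = word (rev xs)"
    using inv_word[OF xsS] by simp
  obtain ys where ys: "set ys \<subseteq> {s, t}" "length ys = k - Suc ?n"
      "alt_word (k - Suc ?n + Suc ?n) s t = ys @ alt_word (Suc ?n) s t"
    using alt_word_split[of s t "k - Suc ?n" "Suc ?n"] by blast
  have ysS: "set ys \<subseteq> S" using ys(1) st by auto
  have "alt_word k s t = ys @ alt_word (Suc ?n) s t"
    using ys(3) assms(4) by simp
  then have "word (alt_word k s t) = word ys \<otimes> word (alt_word (Suc ?n) s t)"
    using S_words[OF ysS] S_words[OF altS] by (simp only: word_append)
  also have "\<dots> = word (ys @ rev xs)"
    using e1 S_words[OF ysS] S_words[OF xsS] by (simp only: word_append set_rev)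
  finally show ?thesis
    using that[of "ys @ rev xs"] xsS ysS xs(2) ys(2) assms(3,4) by simp
qed

end

section \<open>The geometric representation\<close>

definition linear_functional :: "(('i \<Rightarrow> real) \<Rightarrow> real) \<Rightarrow> bool" where
  "linear_functional \<phi> \<longleftrightarrow> (\<forall>a b x y. \<phi> (\<lambda>i. a * x i + b * y i) = a * \<phi> x + b * \<phi> y)"

lemma linear_functional_comb:
  "linear_functional \<phi> \<Longrightarrow> \<phi> (\<lambda>i. a * x i + b * y i) = a * \<phi> x + b * \<phi> y"
  by (simp add: linear_functional_def)

lemma linear_functional_diff:
  "linear_functional \<phi> \<Longrightarrow> \<phi> (\<lambda>i. x i - b * y i) = \<phi> x - b * \<phi> y"
  using linear_functional_comb[of \<phi> 1 x "-b" y] by simp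

text \<open>The map \<open>P\<close> projects along \<open>h\<close> onto the kernel of \<phi>.
  There \<rho> vanishes wherever \<psi> does, so it is a multiple of \<psi>; the value at
  \<open>h\<close> then determines the coefficient of \<phi>.\<close>

lemma linear_functional_span:
  assumes lin: "linear_functional \<phi>" "linear_functional \<psi>" "linear_functional \<rho>"
    and h: "\<phi> h \<noteq> 0"
    and ker: "\<And>x. \<phi> x = 0 \<Longrightarrow> \<psi> x = 0 \<Longrightarrow> \<rho> x = 0"
  obtains p q where "\<And>x. \<rho> x = p * \<phi> x + q * \<psi> x"
proof -
  define P where "P x = (\<lambda>i. x i - (\<phi> x / \<phi> h) * h i)" for x
  have P\<phi>: "\<phi> (P x) = 0" for x
    unfolding P_def linear_functional_diff[OF lin(1)] using h by simp
  have P\<psi>: "\<psi> (P x) = \<psi> x - \<phi> x / \<phi> h * \<psi> h" for x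
    unfolding P_def linear_functional_diff[OF lin(2)] by simp
  have P\<rho>: "\<rho> (P x) = \<rho> x - \<phi> x / \<phi> h * \<rho> h" for x
    unfolding P_def linear_functional_diff[OF lin(3)] by simp
  show thesis
  proof (cases "\<forall>x. \<psi> (P x) = 0")
    case True
    then have "\<rho> x = (\<rho> h / \<phi> h) * \<phi> x + 0 * \<psi> x" for x
      using ker[of "P x"] P\<phi>[of x] P\<rho>[of x] by (simp add: field_simps)
    then show ?thesis by (rule that)
  next
    case False
    then obtain y where y: "\<psi> (P y) \<noteq> 0" by blast
    define k where "k = \<rho> (P y) / \<psi> (P y)"
    have "\<rho> (P x) = k * \<psi> (P x)" for x
    proof -
      let ?z = "\<lambda>i. P x i - (\<psi> (P x) / \<psi> (P y)) * P y i"
      have "\<phi> ?z = 0" unfolding linear_functional_diff[OF lin(1)] by (simp add: P\<phi>)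
      moreover have "\<psi> ?z = 0" unfolding linear_functional_diff[OF lin(2)] using y by simp
      ultimately have "\<rho> ?z = 0" by (rule ker)
      then show ?thesis unfolding linear_functional_diff[OF lin(3)] using y by (simp add: k_def field_simps)
    qed
    then have "\<rho> x = ((\<rho> h - k * \<psi> h) / \<phi> h) * \<phi> x + k * \<psi> x" for x
      using P\<rho>[of x] P\<psi>[of x] h by (simp add: field_simps)
    then show ?thesis by (rule that)
  qed
qed

context coxeter_matrix_system
begin

text \<open>For \<open>m s t = 0\<close>, the encoding of infinity, \<open>pi / 0 = 0\<close> makes the entry \<open>- 2\<close>, as it should be.\<close>

definition cartan :: "'a \<Rightarrow> 'a \<Rightarrow> real" where
  "cartan s t = - 2 * cos (pi / real (m s t))"

text \<open>The second summand of the index type keeps the simple coroots linearly independent when the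
  Cartan matrix is degenerate. It records the coordinates of a coroot with respect to the simple
  coroots; by symmetry of the Cartan matrix they are also those of the root.\<close>

definition simple_coroot :: "'a \<Rightarrow> 'a + 'a \<Rightarrow> real" where
  "simple_coroot s = case_sum (cartan s) (\<lambda>t. if t = s then 1 else 0)"

text \<open>The simple root of \<open>s\<close> is the coordinate functional at
  \<open>Inl s\<close>; the formula subtracts its value times the simple coroot.\<close>

definition simple_reflection :: "'a \<Rightarrow> ('a + 'a \<Rightarrow> real) \<Rightarrow> ('a + 'a \<Rightarrow> real)" where
  "simple_reflection s x = (\<lambda>i. x i - x (Inl s) * simple_coroot s i)"

definition word_action :: "'a list \<Rightarrow> ('a + 'a \<Rightarrow> real) \<Rightarrow> ('a + 'a \<Rightarrow> real)" where
  "word_action ss = foldr simple_reflection ss"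

lemma word_action_simps [simp]:
  "word_action [] x = x"
  "word_action (s # ss) x = simple_reflection s (word_action ss x)"
  by (simp_all add: word_action_def)

lemma word_action_append: "word_action (xs @ ys) x = word_action xs (word_action ys x)"
  by (simp add: word_action_def)

lemma simple_coroot_simps [simp]:
  "simple_coroot s (Inl t) = cartan s t"
  "simple_coroot s (Inr t) = (if t = s then 1 else 0)"
  by (simp_all add: simple_coroot_def)

lemma cartan_sym: "s \<in> S \<Longrightarrow> t \<in> S \<Longrightarrow> cartan s t = cartan t s"
  by (metis cartan_def m_sym)

lemma cartan_diag: "s \<in> S \<Longrightarrow> cartan s s = 2"
  using m_eq_one_iff[of s s] by (simp add: cartan_def)

lemma simple_reflection_comb:
  "simple_reflection s (\<lambda>i. a * x i + b * y i)
    = (\<lambda>i. a * simple_reflection s x i + b * simple_reflection s y i)"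
  by (auto simp: simple_reflection_def algebra_simps)

lemma word_action_comb:
  "word_action ss (\<lambda>i. a * x i + b * y i) = (\<lambda>i. a * word_action ss x i + b * word_action ss y i)"
  by (induction ss) (simp_all add: simple_reflection_comb)

lemma simple_reflection_involution:
  "s \<in> S \<Longrightarrow> simple_reflection s (simple_reflection s x) = x"
  by (auto simp: simple_reflection_def cartan_diag)

text \<open>A vector splits into a part killed by both roots, which never moves, and a combination
  of the two coroots. On the two coefficients the reflections advance a sequence with recursion
  \<open>h (j + 2) = 2 * c * h (j + 1) - h j\<close>, whose solutions have period
  \<open>2 * m s t\<close>.\<close>

lemma word_action_relator:
  assumes s: "s \<in> S" and t: "t \<in> S"
  shows "word_action (concat (replicate (m s t) [s, t])) x = x"
proof (cases "s = t \<or> m s t = 0")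
  case True
  have "m s s = 1" using m_eq_one_iff s by blast
  with True show ?thesis using s by (auto simp: simple_reflection_involution)
next
  case False
  define \<theta> where "\<theta> = pi / real (m s t)"
  define c where "c = cos \<theta>"
  have m2: "m s t \<ge> 2" using False m_eq_one_iff[OF s t] by (cases "m s t") auto
  then have "0 < \<theta>" "\<theta> < pi" by (auto simp: \<theta>_def field_simps)
  then have sin0: "sin \<theta> > 0" by (rule sin_gt_zero)
  have c2: "1 - c * c \<noteq> 0"
    using sin0 sin_squared_eq[of \<theta>] by (auto simp: c_def power2_eq_square)
  have A: "cartan s t = - 2 * c" "cartan t s = - 2 * c" "cartan s s = 2" "cartan t t = 2"
    using cartan_sym[OF s t] cartan_diag s t by (auto simp: cartan_def c_def \<theta>_def)
  \<comment> \<open>The values of the two roots at \<open>x\<close> give a linear system for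
    \<open>p\<close> and \<open>q\<close> with determinant \<open>4 * (1 - c * c)\<close>.\<close>
  define p where "p = (x (Inl s) + c * x (Inl t)) / (2 * (1 - c * c))"
  define q where "q = (x (Inl t) + c * x (Inl s)) / (2 * (1 - c * c))"
  define x0 where "x0 = (\<lambda>i. x i - p * simple_coroot s i - q * simple_coroot t i)"
  define E where "E a b = (\<lambda>i. x0 i + a * simple_coroot s i + b * simple_coroot t i)" for a b
  have x0: "x0 (Inl s) = 0" "x0 (Inl t) = 0"
    using c2 by (auto simp: x0_def p_def q_def A field_simps)
  have Es: "simple_reflection s (E a b) = E (2 * c * b - a) b" for a b
    by (auto simp: simple_reflection_def E_def x0 A algebra_simps)
  have Et: "simple_reflection t (E a b) = E a (2 * c * a - b)" for a b
    by (auto simp: simple_reflection_def E_def x0 A algebra_simps)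
  \<comment> \<open>Chosen so that the sequence starts with \<open>h 0 = q\<close> and
    \<open>h 1 = p\<close>.\<close>
  define Y where "Y = (p - q * c) / sin \<theta>"
  define h where "h j = q * cos (real j * \<theta>) + Y * sin (real j * \<theta>)" for j
  have h_rec: "2 * c * h (Suc j) - h j = h (Suc (Suc j))" for j
  proof -
    have a: "real (Suc (Suc j)) * \<theta> = real (Suc j) * \<theta> + \<theta>" "real j * \<theta> = real (Suc j) * \<theta> - \<theta>"
      by (auto simp: algebra_simps)
    show ?thesis
      unfolding h_def c_def a cos_add sin_add cos_diff sin_diff by (simp add: algebra_simps)
  qed
  have "word_action (concat (replicate k [s, t])) (E (h 1) (h 0)) = E (h (2 * k + 1)) (h (2 * k))" for k
    by (induction k) (simp_all add: Es Et h_rec)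
  moreover have "h 0 = q" "h 1 = p"
    using sin0 by (auto simp: h_def Y_def c_def)
  moreover have "E p q = x" by (auto simp: E_def x0_def)
  moreover have "h (2 * m s t) = q" "h (2 * m s t + 1) = p"
  proof -
    have a: "real (2 * m s t) * \<theta> = 2 * pi" using m2 by (simp add: \<theta>_def)
    have b: "real (2 * m s t + 1) * \<theta> = \<theta> + 2 * pi" using a by (simp add: algebra_simps)
    show "h (2 * m s t) = q" unfolding h_def a by simp
    show "h (2 * m s t + 1) = p" unfolding h_def b using sin0 by (auto simp: Y_def c_def)
  qed
  ultimately show ?thesis by metis
qed

text \<open>Signs can be forgotten because simple reflections are involutions, so
  \<open>cancel\<close> is respected as well as the relators.\<close>

lemma word_action_presentation_cong:
  "presentation_cong S (coxeter_relators S m) u v \<Longrightarrow>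
    word_action (map fst u) = word_action (map fst v)"
proof (induction rule: presentation_cong.induct)
  case (append u u' v v')
  then show ?case by (intro ext) (simp add: word_action_append)
next
  case (cancel s b)
  then show ?case by (auto simp: simple_reflection_involution fun_eq_iff)
next
  case (relator r)
  then obtain s t where r: "r = concat (replicate (m s t) [(s, True), (t, True)])" "s \<in> S" "t \<in> S"
    unfolding coxeter_relators_def by auto
  have "map fst (concat (replicate k [(s, True), (t, True)])) = concat (replicate k [s, t])" for k
    by (induction k) auto
  with r show ?case by (auto simp: word_action_relator fun_eq_iff)
qed auto

section \<open>From words to group elements\<close>

lemma word_action_rev:
  "set ss \<subseteq> S \<Longrightarrow> word_action ss (word_action (rev ss) x) = x"
  by (induction ss arbitrary: x) (auto simp: word_action_append simple_reflection_involution)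

lemma word_action_cong:
  assumes "set xs \<subseteq> S" "set ys \<subseteq> S" "word xs = word ys"
  shows "word_action xs x = word_action ys x"
proof -
  have "word (rev ys @ xs) = inv (word ys) \<otimes> word xs"
    using assms S_words by (simp add: word_append inv_word)
  also have "\<dots> = \<one>" using assms S_words by simp
  finally have "presentation_cong S (coxeter_relators S m) (map (\<lambda>s. (s, True)) (rev ys @ xs)) []"
    using word_eq_one_iff[of "rev ys @ xs"] assms by auto
  from word_action_presentation_cong[OF this] have "word_action (rev ys @ xs) = word_action []"
    by (simp add: comp_def)
  then have "word_action ys (word_action (rev ys @ xs) x) = word_action ys x" by simp
  then show ?thesis using assms(2) by (simp add: word_action_append word_action_rev)
qed

text \<open>By \<open>word_action_cong\<close> all words for a group element act alike, so the
  choice is harmless.\<close>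

definition action :: "'a \<Rightarrow> ('a + 'a \<Rightarrow> real) \<Rightarrow> ('a + 'a \<Rightarrow> real)" where
  "action g = word_action (SOME ss. set ss \<subseteq> S \<and> word ss = g)"

lemma action_word:
  assumes "set ss \<subseteq> S"
  shows "action (word ss) x = word_action ss x"
proof -
  have "\<exists>us. set us \<subseteq> S \<and> word us = word ss" using assms by blast
  from someI_ex[OF this] show ?thesis
    unfolding action_def using word_action_cong assms by blast
qed

lemma action_mult:
  assumes "g \<in> carrier G" "h \<in> carrier G"
  shows "action (g \<otimes> h) x = action g (action h x)"
proof -
  obtain xs where xs: "set xs \<subseteq> S" "word xs = g" using carrier_word assms(1) by blast
  obtain ys where ys: "set ys \<subseteq> S" "word ys = h" using carrier_word assms(2) by blast
  have "g \<otimes> h = word (xs @ ys)" using xs ys S_words by (simp add: word_append)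
  moreover have "set (xs @ ys) \<subseteq> S" using xs ys by simp
  ultimately have "action (g \<otimes> h) x = word_action (xs @ ys) x" using action_word by simp
  also have "\<dots> = action g (action h x)"
    using action_word[OF xs(1)] action_word[OF ys(1)] xs(2) ys(2) by (simp add: word_action_append)
  finally show ?thesis .
qed

lemma action_one [simp]: "action \<one> x = x"
  using action_word[of "[]"] by simp

lemma action_generator: "s \<in> S \<Longrightarrow> action s x = simple_reflection s x"
  using action_word[of "[s]"] S_carrier by simp

lemma action_inv [simp]:
  "g \<in> carrier G \<Longrightarrow> action g (action (inv g) x) = x"
  "g \<in> carrier G \<Longrightarrow> action (inv g) (action g x) = x"
  using action_mult[of g "inv g" x] action_mult[of "inv g" g x] by simp_all

lemma action_comb:
  "action g (\<lambda>i. a * x i + b * y i) = (\<lambda>i. a * action g x i + b * action g y i)"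
  by (simp add: action_def word_action_comb)

lemma action_diff: "action g (\<lambda>i. x i - b * y i) = (\<lambda>i. action g x i - b * action g y i)"
  using action_comb[of g 1 x "-b" y] by simp

text \<open>In the pairing of roots with coroots this is the invariance of the symmetric form:
  \<open>w\<close> moves to the other argument as its inverse. The symmetry of the Cartan matrix
  enters here.\<close>

lemma word_action_symmetry:
  assumes "set ss \<subseteq> S" "s \<in> S" "u \<in> S"
  shows "word_action (rev ss) (simple_coroot u) (Inl s) = word_action ss (simple_coroot s) (Inl u)"
  using assms
proof (induction ss arbitrary: u)
  case Nil
  then show ?case by (simp add: cartan_sym)
next
  case (Cons v ss)
  have "word_action (rev ss) (simple_reflection v (simple_coroot u)) (Inl s)
      = word_action (rev ss) (simple_coroot u) (Inl s)
        - cartan u v * word_action (rev ss) (simple_coroot v) (Inl s)"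
    using word_action_comb[of "rev ss" 1 "simple_coroot u" "- cartan u v" "simple_coroot v"]
    by (simp add: simple_reflection_def)
  then show ?case
    using Cons cartan_sym[of u v]
    by (simp add: word_action_append simple_reflection_def)
qed

section \<open>Roots and coroots\<close>

definition root_form :: "'a \<Rightarrow> 'a \<Rightarrow> ('a + 'a \<Rightarrow> real) \<Rightarrow> real" where
  "root_form w s x = action (inv w) x (Inl s)"

text \<open>\<open>root_form w s\<close> is the simple root of \<open>s\<close> moved by
  \<open>w\<close> in the contragredient action, and \<open>coroot w s\<close> is its partner. Pairs
  index them, since \<open>w\<close> and \<open>w \<otimes> s\<close> yield opposite roots of one
  reflection.\<close>

definition coroot :: "'a \<Rightarrow> 'a \<Rightarrow> 'a + 'a \<Rightarrow> real" where
  "coroot w s = action w (simple_coroot s)"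

lemma root_linear: "linear_functional (root_form w s)"
  by (simp add: linear_functional_def root_form_def action_comb)

lemma root_action:
  "g \<in> carrier G \<Longrightarrow> w \<in> carrier G \<Longrightarrow> root_form w s (action g x) = root_form (inv g \<otimes> w) s x"
  by (simp add: root_form_def inv_mult_group action_mult)

lemma root_one: "root_form \<one> s x = x (Inl s)"
  by (simp add: root_form_def)

lemma root_word:
  "set ss \<subseteq> S \<Longrightarrow> root_form (word ss) s x = word_action (rev ss) x (Inl s)"
  using action_word[of "rev ss"] by (simp add: root_form_def inv_word)

lemma coroot_word: "set ss \<subseteq> S \<Longrightarrow> coroot (word ss) s = word_action ss (simple_coroot s)"
  by (auto simp: coroot_def action_word)

lemma root_coroot_simple:
  assumes "w \<in> carrier G" "s \<in> S" "u \<in> S"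
  shows "root_form w s (simple_coroot u) = coroot w s (Inl u)"
proof -
  obtain ss where "set ss \<subseteq> S" "word ss = w" using carrier_word assms(1) by blast
  then show ?thesis
    using word_action_symmetry[of ss s u] root_word[of ss s] coroot_word[of ss s] assms by simp
qed

lemma root_coroot_sym:
  assumes "w \<in> carrier G" "s \<in> S" "w' \<in> carrier G" "s' \<in> S"
  shows "root_form w s (coroot w' s') = root_form w' s' (coroot w s)"
proof -
  have "root_form w s (coroot w' s') = root_form (inv w' \<otimes> w) s (simple_coroot s')"
    unfolding coroot_def using assms by (simp add: root_action)
  also have "\<dots> = coroot (inv w' \<otimes> w) s (Inl s')"
    using assms by (simp add: root_coroot_simple)
  also have "\<dots> = root_form w' s' (coroot w s)"
    using assms by (simp add: coroot_def root_form_def action_mult)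
  finally show ?thesis .
qed

lemma root_coroot_self: "w \<in> carrier G \<Longrightarrow> s \<in> S \<Longrightarrow> root_form w s (coroot w s) = 2"
  by (simp add: root_form_def coroot_def cartan_diag)

lemma action_reflection:
  assumes "w \<in> carrier G" "s \<in> S"
  shows "action (w \<otimes> s \<otimes> inv w) x = (\<lambda>i. x i - root_form w s x * coroot w s i)"
proof -
  have "action (w \<otimes> s \<otimes> inv w) x = action w (simple_reflection s (action (inv w) x))"
    using assms S_carrier by (simp add: action_mult action_generator)
  also have "\<dots> = (\<lambda>i. x i - root_form w s x * coroot w s i)"
    unfolding simple_reflection_def action_diff using assms by (simp add: root_form_def coroot_def)
  finally show ?thesis .
qed

lemma root_mult_generator:
  assumes "w \<in> carrier G" "s \<in> S"
  shows "root_form (w \<otimes> s) s x = - root_form w s x" "coroot (w \<otimes> s) s = (\<lambda>i. - coroot w s i)"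
proof -
  show "root_form (w \<otimes> s) s x = - root_form w s x"
    using assms S_carrier
    by (simp add: root_form_def inv_mult_group action_mult S_inv action_generator
        simple_reflection_def cartan_diag)
  have "simple_reflection s (simple_coroot s) = (\<lambda>i. 0 * simple_coroot s i + (-1) * simple_coroot s i)"
    using assms by (auto simp: simple_reflection_def cartan_diag)
  then show "coroot (w \<otimes> s) s = (\<lambda>i. - coroot w s i)"
    using assms S_carrier action_comb[of w 0 "simple_coroot s" "-1" "simple_coroot s"]
    by (simp add: coroot_def action_mult action_generator)
qed

text \<open>Even for infinite \<open>S\<close> a root is a finite combination of simple roots, and
  its coefficients are the \<open>Inr\<close> entries of the coroot. Each letter \<open>u\<close> of
  a word for \<open>w\<close> changes only the coefficient at \<open>u\<close>.\<close>

lemma root_coordinates: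
  assumes "w \<in> carrier G" "s \<in> S"
  obtains F where "finite F" "\<And>t. t \<notin> F \<Longrightarrow> coroot w s (Inr t) = 0"
    "\<And>x. root_form w s x = (\<Sum>t\<in>F. coroot w s (Inr t) * x (Inl t))"
proof -
  obtain ss where ss: "set ss \<subseteq> S" "word ss = w" using carrier_word assms(1) by blast
  have "\<exists>F. finite F \<and> (\<forall>t. t \<notin> F \<longrightarrow> coroot (word ss) s (Inr t) = 0) \<and>
    (\<forall>x. root_form (word ss) s x = (\<Sum>t\<in>F. coroot (word ss) s (Inr t) * x (Inl t)))"
    using ss(1)
  proof (induction ss)
    case Nil
    show ?case
      by (rule exI[of _ "{s}"]) (simp add: root_form_def coroot_def)
  next
    case (Cons u ss)
    then obtain F where F: "finite F" "\<And>t. t \<notin> F \<Longrightarrow> coroot (word ss) s (Inr t) = 0"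
      "\<And>x. root_form (word ss) s x = (\<Sum>t\<in>F. coroot (word ss) s (Inr t) * x (Inl t))" by auto
    have u: "u \<in> S" "u \<in> carrier G" and w: "word ss \<in> carrier G" "set ss \<subseteq> S"
      using Cons.prems S_words S_carrier by auto
    define h where "h = coroot (word ss) s"
    define F' where "F' = insert u F"
    have F': "finite F'" "\<And>x. root_form (word ss) s x = (\<Sum>t\<in>F'. h (Inr t) * x (Inl t))"
    proof -
      show "finite F'" using F(1) by (simp add: F'_def)
      fix x
      show "root_form (word ss) s x = (\<Sum>t\<in>F'. h (Inr t) * x (Inl t))"
        unfolding F(3) h_def
        by (rule sum.mono_neutral_left) (use F in \<open>auto simp: F'_def\<close>)
    qed
    have cr: "coroot (word (u # ss)) s = (\<lambda>i. h i - h (Inl u) * simple_coroot u i)"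
      using u w by (simp add: coroot_def action_mult action_generator simple_reflection_def h_def)
    have hu: "root_form (word ss) s (simple_coroot u) = h (Inl u)"
      using root_coroot_simple[OF w(1) assms(2) u(1)] by (simp add: h_def)
    have "root_form (word (u # ss)) s x = (\<Sum>t\<in>F'. coroot (word (u # ss)) s (Inr t) * x (Inl t))" for x
    proof -
      have "root_form (word (u # ss)) s x = root_form (word ss) s (action u x)"
        using root_action[of u "word ss" s x] u w S_inv[of u] by simp
      also have "\<dots> = root_form (word ss) s x - x (Inl u) * h (Inl u)"
        using u by (simp add: action_generator simple_reflection_def hu
            linear_functional_diff[OF root_linear])
      also have "\<dots> = (\<Sum>t\<in>F'. h (Inr t) * x (Inl t)) - (\<Sum>t\<in>F'. if t = u then h (Inl u) * x (Inl u) else 0)"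
        using F'(1) F'(2)[of x] by (simp add: F'_def)
      also have "\<dots> = (\<Sum>t\<in>F'. coroot (word (u # ss)) s (Inr t) * x (Inl t))"
        unfolding sum_subtractf[symmetric] cr by (rule sum.cong) (auto simp: algebra_simps)
      finally show ?thesis .
    qed
    moreover have "coroot (word (u # ss)) s (Inr t) = 0" if "t \<notin> F'" for t
      using that F(2)[of t] unfolding cr by (auto simp: F'_def h_def)
    ultimately show ?case using F'(1) by blast
  qed
  then show ?thesis using that ss(2) by blast
qed

text \<open>The \<open>Inr\<close> entries carry the factor over to the root; the \<open>Inl\<close>
  entries alone would not suffice for a degenerate Cartan matrix.\<close>

lemma proportional_coroots:
  assumes w: "w \<in> carrier G" "s \<in> S" "w' \<in> carrier G" "s' \<in> S"
    and eq: "\<And>i. coroot w s i = k * coroot w' s' i"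
  shows "root_form w s x = k * root_form w' s' x"
proof -
  obtain F where F: "finite F" "\<And>t. t \<notin> F \<Longrightarrow> coroot w s (Inr t) = 0"
    "\<And>x. root_form w s x = (\<Sum>t\<in>F. coroot w s (Inr t) * x (Inl t))"
    using root_coordinates w by metis
  obtain F' where F': "finite F'" "\<And>t. t \<notin> F' \<Longrightarrow> coroot w' s' (Inr t) = 0"
    "\<And>x. root_form w' s' x = (\<Sum>t\<in>F'. coroot w' s' (Inr t) * x (Inl t))"
    using root_coordinates w by metis
  have "root_form w s x = (\<Sum>t\<in>F \<union> F'. coroot w s (Inr t) * x (Inl t))"
    unfolding F(3) by (rule sum.mono_neutral_left) (use F F' in auto)
  also have "\<dots> = k * (\<Sum>t\<in>F \<union> F'. coroot w' s' (Inr t) * x (Inl t))"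
    by (simp add: eq sum_distrib_left mult.assoc)
  also have "(\<Sum>t\<in>F \<union> F'. coroot w' s' (Inr t) * x (Inl t)) = root_form w' s' x"
    unfolding F'(3) by (rule sum.mono_neutral_right) (use F F' in auto)
  finally show ?thesis .
qed

section \<open>Positive and negative roots\<close>

text \<open>Signs are tested on the fundamental chamber rather than on coefficients, so they make
  sense for any functional, in particular for a root composed with an action.\<close>

definition nonneg :: "(('a + 'a \<Rightarrow> real) \<Rightarrow> real) \<Rightarrow> bool" where
  "nonneg \<phi> \<longleftrightarrow> (\<forall>x. (\<forall>s\<in>S. x (Inl s) \<ge> 0) \<longrightarrow> \<phi> x \<ge> 0)"

definition nonpos :: "(('a + 'a \<Rightarrow> real) \<Rightarrow> real) \<Rightarrow> bool" where
  "nonpos \<phi> \<longleftrightarrow> (\<forall>x. (\<forall>s\<in>S. x (Inl s) \<ge> 0) \<longrightarrow> \<phi> x \<le> 0)"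

lemma nonneg_minus [simp]: "nonneg (\<lambda>x. - \<phi> x) \<longleftrightarrow> nonpos \<phi>"
  and nonpos_minus [simp]: "nonpos (\<lambda>x. - \<phi> x) \<longleftrightarrow> nonneg \<phi>"
  by (auto simp: nonneg_def nonpos_def)

text \<open>The coefficients \<open>U j\<close> of the roots of a dihedral parabolic subgroup are values of
  Chebyshev polynomials, nonnegative as long as the alternating word stays reduced.\<close>

lemma dihedral_root:
  assumes s: "s \<in> S" and t: "t \<in> S" and st: "s \<noteq> t" and k: "m s t = 0 \<or> k < m s t"
  obtains a b where "a \<ge> 0" "b \<ge> 0"
    "\<And>y. word_action (rev (alt_word k t s)) y (Inl s) = a * y (Inl s) + b * y (Inl t)"
proof -
  define \<theta> where "\<theta> = pi / real (m s t)"
  define c where "c = cos \<theta>"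
  have A: "cartan s t = - 2 * c" "cartan t s = - 2 * c" "cartan s s = 2" "cartan t t = 2"
    using cartan_sym[OF s t] cartan_diag s t by (auto simp: cartan_def c_def \<theta>_def)
  define U where "U j = (if m s t = 0 then real j else sin (real j * \<theta>) / sin \<theta>)" for j
  have sin0: "sin \<theta> > 0" if "m s t \<noteq> 0"
  proof -
    have "m s t \<ge> 2" using that st m_eq_one_iff[OF s t] by (cases "m s t") auto
    then have "0 < \<theta>" "\<theta> < pi" by (auto simp: \<theta>_def field_simps)
    then show ?thesis by (rule sin_gt_zero)
  qed
  have U01: "U 0 = 0" "U (Suc 0) = 1"
    using sin0 by (cases "m s t = 0"; simp add: U_def)+
  have U_rec: "U (Suc (Suc j)) = 2 * c * U (Suc j) - U j" for j
  proof (cases "m s t = 0")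
    case True
    then show ?thesis by (simp add: U_def c_def \<theta>_def)
  next
    case False
    have a: "real (Suc (Suc j)) * \<theta> = real (Suc j) * \<theta> + \<theta>" "real j * \<theta> = real (Suc j) * \<theta> - \<theta>"
      by (auto simp: algebra_simps)
    have "sin (real (Suc (Suc j)) * \<theta>) = 2 * c * sin (real (Suc j) * \<theta>) - sin (real j * \<theta>)"
      unfolding a c_def sin_add sin_diff by simp
    with False sin0 show ?thesis by (simp add: U_def diff_divide_distrib)
  qed
  have U_nonneg: "U j \<ge> 0" if "m s t = 0 \<or> j \<le> m s t" for j
  proof (cases "m s t = 0")
    case True
    then show ?thesis by (simp add: U_def)
  next
    case False
    with that have "real j \<le> real (m s t)" by simp
    then have "real j * \<theta> \<le> pi"
      using False mult_right_mono[of "real j" "real (m s t)" pi] by (simp add: \<theta>_def field_simps)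
    moreover have "0 \<le> real j * \<theta>" by (simp add: \<theta>_def)
    ultimately have "sin (real j * \<theta>) \<ge> 0" by (intro sin_ge_zero)
    with False sin0 show ?thesis by (simp add: U_def)
  qed
  have form: "word_action (rev (alt_word j t s)) y (Inl s)
      = (if even j then U (Suc j) * y (Inl s) + U j * y (Inl t)
         else U j * y (Inl s) + U (Suc j) * y (Inl t))" for j y
  proof (induction j arbitrary: y)
    case (Suc j)
    have step: "word_action (rev (alt_word (Suc j) t s)) y
        = word_action (rev (alt_word j t s)) (simple_reflection (if even j then t else s) y)"
      unfolding alt_word_Cons by (simp add: word_action_append)
    show ?case
      unfolding step Suc.IH by (auto simp: simple_reflection_def A U_rec algebra_simps)
  qed (simp add: U01)
  have "U k \<ge> 0" "U (Suc k) \<ge> 0" using k by (auto intro: U_nonneg)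
  then show ?thesis
    using form[of k] by (cases "even k") (auto intro: that[of "U (Suc k)" "U k"] that[of "U k" "U (Suc k)"])
qed

text \<open>This splits \<open>w\<close> along the parabolic subgroup of \<open>s\<close> and
  \<open>t\<close>; \<open>k\<close> is the greatest length of an alternating suffix that ends in
  \<open>t\<close> and can be split off with lengths adding up. A descent of \<open>v\<close> at the
  letter preceding this suffix would lengthen it; a descent at its first letter would make
  \<open>w\<close> too short.\<close>

lemma alt_suffix_decomposition:
  assumes w: "w \<in> carrier G" and s: "s \<in> S" and t: "t \<in> S" and descent: "len (w \<otimes> t) < len w"
  obtains k v where "v \<in> carrier G" "k > 0" "w = v \<otimes> word (alt_word k t s)" "len w = len v + k"
    "len v \<le> len (v \<otimes> s)" "len v \<le> len (v \<otimes> t)"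
proof -
  define Q where "Q k \<longleftrightarrow> (\<exists>v\<in>carrier G. w = v \<otimes> word (alt_word k t s) \<and> len w = len v + k)" for k
  note carr = S_carrier[OF s] S_carrier[OF t]
  have altS: "set (alt_word j t s) \<subseteq> S" for j using set_alt_word[of j t s] s t by auto
  note altc = word_closed[OF S_words[OF altS]]
  have step: "len (g \<otimes> p) + 1 = len g"
    if "g \<in> carrier G" "p \<in> S" "len (g \<otimes> p) < len g" for g p
  proof -
    have "len g = len (g \<otimes> p \<otimes> p)"
      using that S_carrier by (simp add: m_assoc S_square)
    also have "\<dots> \<le> len (g \<otimes> p) + len p"
      using that S_carrier by (intro len_mult_le) auto
    finally show ?thesis using len_generator[OF that(2)] that(3) by simp
  qed
  have cancel: "g \<otimes> h = (g \<otimes> p) \<otimes> (p \<otimes> h)" if "g \<in> carrier G" "h \<in> carrier G" "p \<in> S" for g h p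
  proof -
    have "(g \<otimes> p) \<otimes> (p \<otimes> h) = g \<otimes> (p \<otimes> p) \<otimes> h"
      using that S_carrier by (simp add: m_assoc)
    then show ?thesis using that S_square by simp
  qed
  have "Q 1"
    unfolding Q_def
    using step[OF w t descent] w carr t
    by (intro bexI[of _ "w \<otimes> t"]) (auto simp: m_assoc S_square)
  moreover have bound: "\<forall>j. Q j \<longrightarrow> j \<le> len w" by (auto simp: Q_def)
  ultimately obtain k where k: "Q k" "\<And>j. Q j \<Longrightarrow> j \<le> k"
    by (metis Greatest_le_nat GreatestI_nat)
  have k0: "k > 0" using k(2)[OF \<open>Q 1\<close>] by simp
  obtain v where v: "v \<in> carrier G" "w = v \<otimes> word (alt_word k t s)" "len w = len v + k"
    using k(1) unfolding Q_def by blast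
  obtain k' where k': "k = Suc k'" using k0 by (cases k) auto
  \<comment> \<open>\<open>p\<close> is the first letter of the suffix, \<open>q\<close> the one
    that would extend it to the left.\<close>
  define p where "p = (if even k' then t else s)"
  define q where "q = (if even k' then s else t)"
  have pq: "p \<in> S" "q \<in> S" using s t by (auto simp: p_def q_def)
  have alt_p: "word (alt_word k t s) = p \<otimes> word (alt_word k' t s)"
    unfolding k' alt_word_Cons by (simp add: p_def)
  have alt_q: "word (alt_word (Suc k) t s) = q \<otimes> word (alt_word k t s)"
  proof -
    have "even k \<longleftrightarrow> odd k'" using k' by simp
    then show ?thesis by (simp add: alt_word_Cons[of k] q_def del: alt_word.simps)
  qed
  have len_p: "len v \<le> len (v \<otimes> p)"
  proof (rule ccontr)
    assume a: "\<not> ?thesis"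
    have "w = (v \<otimes> p) \<otimes> word (alt_word k' t s)"
      using v alt_p S_carrier[OF pq(1)] altc[of k'] by (simp add: m_assoc)
    then have "len w \<le> len (v \<otimes> p) + len (word (alt_word k' t s))"
      using v S_carrier[OF pq(1)] altc[of k'] len_mult_le[of "v \<otimes> p" "word (alt_word k' t s)"] by simp
    then show False using len_le[OF altS[of k']] v(3) k' a by simp
  qed
  have len_q: "len v \<le> len (v \<otimes> q)"
  proof (rule ccontr)
    assume a: "\<not> ?thesis"
    have "w = (v \<otimes> q) \<otimes> word (alt_word (Suc k) t s)"
      using v alt_q cancel[OF v(1) altc[of k] pq(2)] by simp
    moreover have "len w = len (v \<otimes> q) + Suc k"
      using step[OF v(1) pq(2)] a v(3) by simp
    ultimately have "Q (Suc k)"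
      unfolding Q_def using v(1) S_carrier[OF pq(2)] by (intro bexI[of _ "v \<otimes> q"]) auto
    then show False using k(2) by fastforce
  qed
  from len_p len_q have "len v \<le> len (v \<otimes> s)" "len v \<le> len (v \<otimes> t)"
    by (auto simp: p_def q_def split: if_splits)
  with v k0 show ?thesis by (intro that)
qed

text \<open>Since \<open>s\<close> is no descent of \<open>w\<close>, a descent \<open>t\<close>
  differs from \<open>s\<close>. The alternating suffix of \<open>w\<close> turns the simple root of
  \<open>s\<close> into a nonnegative combination of those of \<open>s\<close> and \<open>t\<close>,
  and the shorter \<open>v\<close> keeps both nonnegative by induction.\<close>

lemma root_nonneg:
  assumes "w \<in> carrier G" "s \<in> S" "len w \<le> len (w \<otimes> s)"
  shows "nonneg (root_form w s)"
  using assms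
proof (induction "len w" arbitrary: w s rule: less_induct)
  case less
  note w = less.prems(1) and s = less.prems(2)
  show ?case
  proof (cases "w = \<one>")
    case True
    then show ?thesis using s by (auto simp: nonneg_def root_one)
  next
    case False
    then obtain t where t: "t \<in> S" "len (w \<otimes> t) < len w" using descent_exists w by blast
    then have st: "s \<noteq> t" using less.prems(3) by auto
    obtain k v where v: "v \<in> carrier G" "k > 0" "w = v \<otimes> word (alt_word k t s)" "len w = len v + k"
      "len v \<le> len (v \<otimes> s)" "len v \<le> len (v \<otimes> t)"
      using alt_suffix_decomposition[OF w s t] by blast
    have altS: "set (alt_word k t s) \<subseteq> S" using set_alt_word[of k t s] s t(1) by auto
    have altc: "word (alt_word k t s) \<in> carrier G" using altS S_words by simp
    \<comment> \<open>Otherwise the alternating word of length \<open>k + 1\<close> in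
      \<open>w \<otimes> s\<close> could be shortened by two letters, making \<open>s\<close> a
      descent.\<close>
    have k: "m s t = 0 \<or> k < m s t"
    proof (rule ccontr)
      assume a: "\<not> ?thesis"
      obtain us where us: "set us \<subseteq> S" "length us \<le> Suc k - 2" "word us = word (alt_word (Suc k) s t)"
        using alt_word_short[OF s t(1), of "Suc k"] a by auto
      have "word (alt_word (Suc k) s t) = word (alt_word k t s) \<otimes> s"
        using altS S_words[OF altS] S_carrier[OF s] by (simp add: word_append)
      then have "w \<otimes> s = v \<otimes> word us"
        unfolding v(3) us(3) using v(1) altc S_carrier[OF s] by (simp add: m_assoc)
      then have "len (w \<otimes> s) \<le> len v + len (word us)"
        using len_mult_le[of v "word us"] v(1) S_words[OF us(1)] by simp
      then show False using len_le[OF us(1)] us(2) v(2,4) less.prems(3) by simp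
    qed
    obtain a b where ab: "a \<ge> 0" "b \<ge> 0"
      "\<And>y. word_action (rev (alt_word k t s)) y (Inl s) = a * y (Inl s) + b * y (Inl t)"
      using dihedral_root[OF s t(1) st k] by blast
    have lt: "len v < len w" using v by simp
    have pos: "nonneg (root_form v s)" "nonneg (root_form v t)"
      using less.hyps[OF lt v(1) s v(5)] less.hyps[OF lt v(1) t(1) v(6)] by auto
    have "root_form w s x = a * root_form v s x + b * root_form v t x" for x
    proof -
      have "root_form w s x = action (word (rev (alt_word k t s))) (action (inv v) x) (Inl s)"
        unfolding v(3) root_form_def using v(1) altc altS
        by (simp add: inv_mult_group action_mult inv_word[symmetric])
      also have "\<dots> = word_action (rev (alt_word k t s)) (action (inv v) x) (Inl s)"
        using action_word[of "rev (alt_word k t s)"] altS by simp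
      finally show ?thesis by (simp add: ab(3) root_form_def)
    qed
    with pos ab(1,2) show ?thesis by (auto simp: nonneg_def)
  qed
qed

lemma root_nonpos:
  assumes "w \<in> carrier G" "s \<in> S" "len (w \<otimes> s) < len w"
  shows "nonpos (root_form w s)"
proof -
  have "nonneg (root_form (w \<otimes> s) s)"
    using assms S_carrier by (intro root_nonneg) (auto simp: m_assoc S_square)
  then show ?thesis
    using root_mult_generator(1)[OF assms(1,2)] by (simp add: nonneg_def nonpos_def)
qed

lemma root_sign: "w \<in> carrier G \<Longrightarrow> s \<in> S \<Longrightarrow> nonneg (root_form w s) \<or> nonpos (root_form w s)"
  using root_nonneg root_nonpos by (meson not_le)

text \<open>The functional vanishes on the chamber, and every vector is a difference of two vectors
  in it.\<close>

lemma nonneg_nonpos_zero: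
  assumes "linear_functional \<phi>" "nonneg \<phi>" "nonpos \<phi>"
  shows "\<phi> x = 0"
proof -
  define p n where "p = (\<lambda>i. max (x i) 0)" and "n = (\<lambda>i. max (- x i) 0)"
  have "\<phi> p = 0" "\<phi> n = 0"
    using assms by (auto simp: nonneg_def nonpos_def p_def n_def intro!: antisym)
  moreover have "x = (\<lambda>i. p i - 1 * n i)" by (auto simp: p_def n_def)
  ultimately show ?thesis using linear_functional_diff[OF assms(1)] by (metis diff_zero mult_zero_right)
qed

lemma root_not_nonneg_nonpos:
  assumes "w \<in> carrier G" "s \<in> S" "nonneg (root_form w s)" shows "\<not> nonpos (root_form w s)"
  using nonneg_nonpos_zero[OF root_linear assms(3), of "coroot w s"]
    root_coroot_self[OF assms(1,2)] by auto

text \<open>A nontrivial element has a descent, which makes a root nonpositive. This faithfulness is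
  how equality in the group is read off from roots.\<close>

lemma all_roots_nonneg:
  assumes "w \<in> carrier G" "\<And>s. s \<in> S \<Longrightarrow> nonneg (root_form w s)"
  shows "w = \<one>"
proof (rule ccontr)
  assume "w \<noteq> \<one>"
  then obtain s where s: "s \<in> S" "len (w \<otimes> s) < len w" using descent_exists assms(1) by blast
  then show False using root_nonpos root_not_nonneg_nonpos assms by blast
qed

text \<open>Let \<open>r\<close> be the reflection in question. Then \<open>r \<otimes> s\<close>
  fixes the simple root of \<open>s\<close> and adds a multiple of it to every other simple root;
  these keep a coefficient 1 and hence stay positive, so \<open>r \<otimes> s\<close> is
  trivial.\<close>

lemma proportional_to_simple_root:
  assumes w: "w \<in> carrier G" and u: "u \<in> S" and s: "s \<in> S"
    and eq: "\<And>x. root_form w u x = k * x (Inl s)"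
  shows "w \<otimes> u \<otimes> inv w = s"
proof -
  define r where "r = w \<otimes> u \<otimes> inv w"
  define h where "h = coroot w u"
  have carr: "r \<in> carrier G" "s \<in> carrier G"
    using w u s S_carrier by (auto simp: r_def)
  have rr: "inv r = r"
    using w u S_carrier S_inv by (simp add: r_def inv_mult_group m_assoc)
  have kh: "k * h (Inl s) = 2"
    using root_coroot_self[OF w u] eq by (simp add: h_def)
  have act_r: "action r x i = x i - k * x (Inl s) * h i" for x i
    unfolding r_def action_reflection[OF w u] eq h_def by simp
  have val: "root_form (r \<otimes> s) v x = x (Inl v) + x (Inl s) * (cartan s v - k * h (Inl v))" for v x
  proof -
    have "k * x (Inl s) * h (Inl s) = 2 * x (Inl s)"
      using kh by (metis mult.assoc mult.commute)
    then have act_s: "action r x (Inl s) = - x (Inl s)" by (simp add: act_r)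
    have "root_form (r \<otimes> s) v x = action r x (Inl v) - action r x (Inl s) * cartan s v"
      using carr s by (simp add: root_form_def inv_mult_group rr S_inv action_mult action_generator
          simple_reflection_def)
    then show ?thesis unfolding act_s act_r[of x "Inl v"] by (simp add: algebra_simps)
  qed
  have "nonneg (root_form (r \<otimes> s) v)" if v: "v \<in> S" for v
  proof (cases "v = s")
    case True
    then show ?thesis
      unfolding nonneg_def val using s kh by (simp add: cartan_diag)
  next
    case False
    have "\<not> nonpos (root_form (r \<otimes> s) v)"
    proof
      assume "nonpos (root_form (r \<otimes> s) v)"
      \<comment> \<open>The test vector reads off the coefficient at \<open>v\<close>, which is
        1.\<close>
      then have "root_form (r \<otimes> s) v (\<lambda>i. if i = Inl v then 1 else 0) \<le> 0"
        by (auto simp: nonpos_def)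
      then show False using False by (simp add: val)
    qed
    then show ?thesis using root_sign[of "r \<otimes> s" v] carr v by auto
  qed
  then have "r \<otimes> s = \<one>" using all_roots_nonneg carr by simp
  then have "r = inv s" using carr by (metis inv_equality)
  then show ?thesis using S_inv[OF s] by (simp add: r_def)
qed

section \<open>Reflections and the exchange condition\<close>

text \<open>Root and coroot come from one pair \<open>(w, s)\<close>, so that their signs match; the
  sign itself stays free until \<open>nonneg\<close> fixes it.\<close>

definition has_root :: "'a \<Rightarrow> (('a + 'a \<Rightarrow> real) \<Rightarrow> real) \<Rightarrow> ('a + 'a \<Rightarrow> real) \<Rightarrow> bool" where
  "has_root r \<phi> h \<longleftrightarrow>
     (\<exists>w\<in>carrier G. \<exists>s\<in>S. r = w \<otimes> s \<otimes> inv w \<and> \<phi> = root_form w s \<and> h = coroot w s)"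

lemma has_rootE:
  assumes "has_root r \<phi> h"
  obtains w s where "w \<in> carrier G" "s \<in> S" "r = w \<otimes> s \<otimes> inv w" "\<phi> = root_form w s" "h = coroot w s"
  using assms unfolding has_root_def by blast

lemma has_root_minus:
  assumes "has_root r \<phi> h"
  shows "has_root r (\<lambda>x. - \<phi> x) (\<lambda>i. - h i)"
proof -
  obtain w s where w: "w \<in> carrier G" "s \<in> S" "r = w \<otimes> s \<otimes> inv w" "\<phi> = root_form w s" "h = coroot w s"
    using assms by (rule has_rootE)
  have "(w \<otimes> s) \<otimes> s \<otimes> inv (w \<otimes> s) = r"
    using w S_carrier by (simp add: m_assoc inv_mult_group S_inv S_square)
  then show ?thesis
    unfolding has_root_def using w S_carrier root_mult_generator[of w s]
    by (intro bexI[of _ "w \<otimes> s"] bexI[of _ s]) (auto simp: fun_eq_iff)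
qed

lemma reflection_has_root:
  assumes "r \<in> T"
  obtains \<phi> h where "has_root r \<phi> h" "nonneg \<phi>"
proof -
  obtain w s where w: "w \<in> carrier G" "s \<in> S" "r = w \<otimes> s \<otimes> inv w"
    using assms unfolding reflections_def by blast
  then have *: "has_root r (root_form w s) (coroot w s)" unfolding has_root_def by blast
  show thesis
  proof (cases "nonneg (root_form w s)")
    case True
    with * show ?thesis by (rule that)
  next
    case False
    then have "nonneg (\<lambda>x. - root_form w s x)" using root_sign w by auto
    with has_root_minus[OF *] show ?thesis by (rule that)
  qed
qed

section \<open>Calculus of reflections and their roots\<close>

lemma has_root_reflection: "has_root r \<phi> h \<Longrightarrow> r \<in> T"
  unfolding has_root_def reflections_def by blast

lemma reflection_closed: "r \<in> T \<Longrightarrow> r \<in> carrier G"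
  using S_carrier by (auto simp: reflections_def)

lemma reflection_conj:
  assumes "r \<in> T" "g \<in> carrier G" shows "g \<otimes> r \<otimes> inv g \<in> T"
proof -
  obtain w s where w: "w \<in> carrier G" "s \<in> S" "r = w \<otimes> s \<otimes> inv w"
    using assms unfolding reflections_def by blast
  then have "g \<otimes> r \<otimes> inv g = (g \<otimes> w) \<otimes> s \<otimes> inv (g \<otimes> w)"
    using assms(2) S_carrier by (simp add: inv_mult_group m_assoc)
  then show ?thesis unfolding reflections_def using w assms(2) by blast
qed

lemma reflection_inv:
  assumes "r \<in> T" shows "inv r = r"
proof -
  obtain w s where w: "w \<in> carrier G" "s \<in> S" "r = w \<otimes> s \<otimes> inv w"
    using assms unfolding reflections_def by blast
  then show ?thesis using S_carrier S_inv by (simp add: inv_mult_group m_assoc)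
qed

lemma reflection_square: "r \<in> T \<Longrightarrow> r \<otimes> r = \<one>"
  using reflection_inv[of r] reflection_closed[of r] r_inv[of r] by simp

lemma has_root_linear: "has_root r \<phi> h \<Longrightarrow> linear_functional \<phi>"
  unfolding has_root_def using root_linear by blast

lemma has_root_self: "has_root r \<phi> h \<Longrightarrow> \<phi> h = 2"
  unfolding has_root_def using root_coroot_self by blast

lemma has_root_sign: "has_root r \<phi> h \<Longrightarrow> nonneg \<phi> \<or> nonpos \<phi>"
  unfolding has_root_def using root_sign by blast

lemma has_root_not_both: "has_root r \<phi> h \<Longrightarrow> nonneg \<phi> \<Longrightarrow> \<not> nonpos \<phi>"
  unfolding has_root_def using root_not_nonneg_nonpos by blast

lemma has_root_action: "has_root r \<phi> h \<Longrightarrow> action r x = (\<lambda>i. x i - \<phi> x * h i)"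
  unfolding has_root_def using action_reflection by blast

lemma has_root_sym: "has_root r \<phi> h \<Longrightarrow> has_root r' \<phi>' h' \<Longrightarrow> \<phi> h' = \<phi>' h"
  unfolding has_root_def using root_coroot_sym by blast

lemma linear_action_reflection:
  "linear_functional \<psi> \<Longrightarrow> has_root r \<phi> h \<Longrightarrow> \<psi> (action r x) = \<psi> x - \<phi> x * \<psi> h"
  by (simp add: has_root_action linear_functional_diff)

lemma has_root_action_self: "has_root r \<phi> h \<Longrightarrow> \<phi> (action r x) = - \<phi> x"
  using linear_action_reflection[of \<phi> r \<phi> h x] has_root_linear[of r \<phi> h] has_root_self[of r \<phi> h]
  by simp

lemma has_root_conj:
  assumes "has_root r \<phi> h" "g \<in> carrier G"
  shows "has_root (inv g \<otimes> r \<otimes> g) (\<lambda>x. \<phi> (action g x)) (action (inv g) h)"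
proof -
  obtain w s where w: "w \<in> carrier G" "s \<in> S" "r = w \<otimes> s \<otimes> inv w" "\<phi> = root_form w s" "h = coroot w s"
    using assms(1) by (rule has_rootE)
  have "inv g \<otimes> r \<otimes> g = (inv g \<otimes> w) \<otimes> s \<otimes> inv (inv g \<otimes> w)"
    using w assms(2) S_carrier by (simp add: inv_mult_group m_assoc)
  moreover have "(\<lambda>x. \<phi> (action g x)) = root_form (inv g \<otimes> w) s"
    using w assms(2) by (auto simp: root_action)
  moreover have "action (inv g) h = coroot (inv g \<otimes> w) s"
    using w assms(2) by (auto simp: coroot_def action_mult)
  ultimately show ?thesis unfolding has_root_def using w assms(2) by blast
qed

text \<open>Conjugation by the inverse of \<open>w'\<close> reduces this to the case where the
  second root is simple.\<close>

lemma proportional_roots: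
  assumes r: "has_root r \<phi> h" and r': "has_root r' \<phi>' h'" and eq: "\<And>x. \<phi> x = k * \<phi>' x"
  shows "r = r'"
proof -
  obtain w s where w: "w \<in> carrier G" "s \<in> S" "r = w \<otimes> s \<otimes> inv w" "\<phi> = root_form w s"
    using r by (rule has_rootE)
  obtain w' s' where w': "w' \<in> carrier G" "s' \<in> S" "r' = w' \<otimes> s' \<otimes> inv w'" "\<phi>' = root_form w' s'"
    using r' by (rule has_rootE)
  have "root_form (inv w' \<otimes> w) s x = k * x (Inl s')" for x
    using eq[of "action w' x"] w w' by (simp add: root_action root_one)
  then have "(inv w' \<otimes> w) \<otimes> s \<otimes> inv (inv w' \<otimes> w) = s'"
    using proportional_to_simple_root[of "inv w' \<otimes> w" s s' k] w w' by simp
  then have "r' = w' \<otimes> ((inv w' \<otimes> w) \<otimes> s \<otimes> inv (inv w' \<otimes> w)) \<otimes> inv w'"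
    using w'(3) by simp
  also have "\<dots> = r"
    unfolding w(3) using w(1,2) w'(1) S_carrier
    by (simp add: inv_mult_group m_assoc)
  finally show ?thesis ..
qed

lemma has_root_generator: "s \<in> S \<Longrightarrow> has_root s (\<lambda>x. x (Inl s)) (simple_coroot s)"
  unfolding has_root_def
  by (intro bexI[of _ \<one>] bexI[of _ s]) (auto simp: root_one coroot_def S_carrier fun_eq_iff)

text \<open>Vectors whose coordinate at \<open>Inl s\<close> is erased are fixed by
  \<open>s\<close>. On them \<phi> has both signs, hence vanishes, so \<phi> is a multiple of the
  simple root of \<open>s\<close>.\<close>

lemma only_simple_root_changes_sign:
  assumes r: "has_root r \<phi> h" and s: "s \<in> S" and "nonneg \<phi>" "nonpos (\<lambda>x. \<phi> (action s x))"
  shows "r = s"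
proof -
  define Z where "Z x = (\<lambda>i. if i = Inl s then 0 else x i)" for x :: "'a + 'a \<Rightarrow> real"
  define e :: "'a + 'a \<Rightarrow> real" where "e = (\<lambda>i. if i = Inl s then 1 else 0)"
  note lin = has_root_linear[OF r]
  have "Z (\<lambda>i. a * x i + b * y i) = (\<lambda>i. a * Z x i + b * Z y i)" for a b x y
    by (auto simp: Z_def)
  then have linZ: "linear_functional (\<lambda>x. \<phi> (Z x))"
    using lin by (simp add: linear_functional_def)
  have "\<phi> (Z x) = 0" for x
  proof (rule nonneg_nonpos_zero[OF linZ])
    show "nonneg (\<lambda>x. \<phi> (Z x))"
      using assms(3) unfolding nonneg_def by (simp add: Z_def)
    have "action s (Z x) = Z x" for x
      using s by (simp add: action_generator simple_reflection_def Z_def)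
    moreover have "\<forall>u\<in>S. x (Inl u) \<ge> 0 \<Longrightarrow> \<forall>u\<in>S. Z x (Inl u) \<ge> 0" for x
      by (simp add: Z_def)
    ultimately show "nonpos (\<lambda>x. \<phi> (Z x))"
      using assms(4) unfolding nonpos_def by metis
  qed
  moreover have "Z x = (\<lambda>i. x i - x (Inl s) * e i)" for x by (auto simp: Z_def e_def)
  ultimately have "\<phi> x = \<phi> e * x (Inl s)" for x
    using linear_functional_diff[OF lin, of x "x (Inl s)" e] by simp
  then show ?thesis using proportional_roots[OF r has_root_generator[OF s]] by blast
qed

text \<open>As the word is read, the root turns from nonnegative to nonpositive at some letter.
  There it belongs to that letter, and conjugating back by the prefix recovers
  \<open>r\<close>.\<close>

lemma strong_exchange:
  assumes "set ss \<subseteq> S" "has_root r \<phi> h" "nonneg \<phi>" "nonpos (\<lambda>x. \<phi> (action (word ss) x))"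
  obtains xs s ys where "ss = xs @ s # ys" "r = word xs \<otimes> s \<otimes> inv (word xs)"
proof -
  have "\<exists>xs s ys. ss = xs @ s # ys \<and> r = word xs \<otimes> s \<otimes> inv (word xs)"
    using assms
  proof (induction ss arbitrary: r \<phi> h)
    case Nil
    then show ?case using has_root_not_both by auto
  next
    case (Cons s ss)
    have s: "s \<in> S" "s \<in> carrier G" and ss: "set ss \<subseteq> S" "set ss \<subseteq> carrier G"
      using Cons.prems(1) S_carrier by auto
    note rc = reflection_closed[OF has_root_reflection[OF Cons.prems(2)]]
    have conj: "has_root (s \<otimes> r \<otimes> s) (\<lambda>x. \<phi> (action s x)) (action s h)"
      using has_root_conj[OF Cons.prems(2) s(2)] S_inv[OF s(1)] by simp
    show ?case
    proof (cases "nonneg (\<lambda>x. \<phi> (action s x))")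
      case True
      have "nonpos (\<lambda>x. \<phi> (action s (action (word ss) x)))"
        using Cons.prems(4) s ss by (simp add: action_mult)
      from Cons.IH[OF ss(1) conj True this] obtain xs u ys
        where x: "ss = xs @ u # ys" "s \<otimes> r \<otimes> s = word xs \<otimes> u \<otimes> inv (word xs)" by blast
      have xc: "word xs \<in> carrier G" "u \<in> carrier G"
        using x(1) ss by auto
      have "r = s \<otimes> (s \<otimes> r \<otimes> s) \<otimes> s"
        using s rc by (simp add: m_assoc S_square S_cancel)
      also have "\<dots> = word (s # xs) \<otimes> u \<otimes> inv (word (s # xs))"
        unfolding x(2) using xc s by (simp add: m_assoc inv_mult_group S_inv)
      finally show ?thesis using x(1) by (metis append_Cons)
    next
      case False
      then have "nonpos (\<lambda>x. \<phi> (action s x))" using has_root_sign[OF conj] by blast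
      then have "r = s" using only_simple_root_changes_sign Cons.prems(2,3) s(1) by blast
      then show ?thesis
        using s by (intro exI[of _ "[]"] exI[of _ s] exI[of _ ss]) simp
    qed
  qed
  then show ?thesis using that by blast
qed

lemma len_delete:
  assumes "set (xs @ s # ys) \<subseteq> S" "r = word xs \<otimes> s \<otimes> inv (word xs)"
  shows "len (r \<otimes> word (xs @ s # ys)) < length (xs @ s # ys)"
proof -
  have c: "word xs \<in> carrier G" "word ys \<in> carrier G" "s \<in> carrier G" "set xs \<subseteq> carrier G"
    "set (s # ys) \<subseteq> carrier G" "set ys \<subseteq> carrier G" "s \<in> S"
    using assms(1) S_carrier word_S_closed[of xs] word_S_closed[of ys] by auto
  have "r \<otimes> word (xs @ s # ys) = word xs \<otimes> s \<otimes> (inv (word xs) \<otimes> word xs) \<otimes> s \<otimes> word ys"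
    unfolding assms(2) using c by (simp add: word_append m_assoc)
  also have "\<dots> = word (xs @ ys)"
    using c by (simp add: word_append m_assoc S_cancel)
  finally show ?thesis using len_le[of "xs @ ys"] assms(1) by simp
qed

text \<open>A sign change deletes a letter. Without one, \<open>r \<otimes> w\<close> has the sign
  change, so multiplying it by \<open>r\<close> shortens it back to \<open>w\<close>.\<close>

lemma len_reflection_mult_less_iff:
  assumes r: "has_root r \<phi> h" "nonneg \<phi>" and w: "w \<in> carrier G"
  shows "len (r \<otimes> w) < len w \<longleftrightarrow> nonpos (\<lambda>x. \<phi> (action w x))"
proof -
  have *: "len (r \<otimes> g) < len g" if g: "g \<in> carrier G" "nonpos (\<lambda>x. \<phi> (action g x))" for g
  proof -
    obtain ss where ss: "set ss \<subseteq> S" "word ss = g" "length ss = len g"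
      using reduced_word g(1) by blast
    obtain xs s ys where "ss = xs @ s # ys" "r = word xs \<otimes> s \<otimes> inv (word xs)"
      using strong_exchange[OF ss(1) r] g(2) ss(2) by blast
    then show ?thesis using len_delete[of xs s ys r] ss by simp
  qed
  note rT = has_root_reflection[OF r(1)]
  note rc = reflection_closed[OF rT]
  show ?thesis
  proof
    assume less: "len (r \<otimes> w) < len w"
    show "nonpos (\<lambda>x. \<phi> (action w x))"
    proof (rule ccontr)
      assume "\<not> ?thesis"
      then have "nonneg (\<lambda>x. \<phi> (action w x))"
        using has_root_sign[OF has_root_conj[OF r(1) w]] by blast
      then have "nonpos (\<lambda>x. \<phi> (action (r \<otimes> w) x))"
        using w rc r(1) by (simp add: action_mult has_root_action_self)
      then have "len (r \<otimes> (r \<otimes> w)) < len (r \<otimes> w)" using * rc w by simp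
      then show False
        using less rc w reflection_square[OF rT] by (simp add: m_assoc[symmetric])
    qed
  qed (use * w in blast)
qed

text \<open>A reflection negates its own root, so strong exchange picks a letter of a reduced word
  and writes \<open>t\<close> as its conjugate by the prefix. Cancellation makes the rest of the
  word the inverse of the prefix, so both halves have equal length.\<close>

lemma reflection_palindrome:
  assumes "t \<in> T"
  obtains w s where "w \<in> carrier G" "s \<in> S" "t = w \<otimes> s \<otimes> inv w" "len t = 2 * len w + 1"
proof -
  obtain \<phi> h where r: "has_root t \<phi> h" "nonneg \<phi>" using reflection_has_root assms by blast
  note tc = reflection_closed[OF assms]
  obtain ss where ss: "set ss \<subseteq> S" "word ss = t" "length ss = len t"
    using reduced_word tc by blast
  have "nonpos (\<lambda>x. \<phi> (action (word ss) x))"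
    using r ss(2) by (simp add: has_root_action_self)
  then obtain xs s ys where x: "ss = xs @ s # ys" "t = word xs \<otimes> s \<otimes> inv (word xs)"
    using strong_exchange[OF ss(1) r] by blast
  have c: "word xs \<in> carrier G" "word ys \<in> carrier G" "s \<in> carrier G" "set xs \<subseteq> carrier G"
    "set (s # ys) \<subseteq> carrier G" "s \<in> S" "set xs \<subseteq> S" "set ys \<subseteq> S"
    using ss(1) x(1) S_carrier word_S_closed[of xs] word_S_closed[of ys] by auto
  have "t = word xs \<otimes> s \<otimes> word ys"
    using ss(2) x(1) c by (simp add: word_append m_assoc)
  then have "word ys = inv (word xs)"
    using x(2) c Units_l_cancel[of "word xs \<otimes> s" "word ys" "inv (word xs)"] by (simp add: Units_eq)
  then have "len (word ys) = len (word xs)" using c by (simp add: len_inv)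
  moreover have "len (word xs) \<le> length xs" "len (word ys) \<le> length ys"
    using len_le c by auto
  moreover have "len t \<le> len (word xs) + 1 + len (word ys)"
  proof -
    have "len t \<le> len (word xs \<otimes> s) + len (word ys)"
      unfolding \<open>t = word xs \<otimes> s \<otimes> word ys\<close> using c by (intro len_mult_le) auto
    also have "len (word xs \<otimes> s) \<le> len (word xs) + len s"
      using c by (intro len_mult_le) auto
    finally show ?thesis using len_generator[OF c(6)] by simp
  qed
  ultimately have "len t = 2 * len (word xs) + 1" using ss(3) x(1) by simp
  with c x(2) show ?thesis by (intro that)
qed

lemma len_conj_le:
  assumes "w \<in> carrier G" "s \<in> S"
  shows "len (w \<otimes> s \<otimes> inv w) \<le> 2 * len w + 1"
proof -
  have "len (w \<otimes> s \<otimes> inv w) \<le> len (w \<otimes> s) + len (inv w)"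
    using assms S_carrier by (intro len_mult_le) auto
  also have "len (w \<otimes> s) \<le> len w + len s"
    using assms S_carrier by (intro len_mult_le) auto
  finally show ?thesis using assms len_generator[of s] len_inv[of w] by simp
qed

section \<open>Canonical generators of reflection subgroups\<close>

abbreviation canon :: "'a set \<Rightarrow> 'a set" where
  "canon \<equiv> canonical_generators G S"

lemma canon_subset: "canon H \<subseteq> T \<inter> H"
  unfolding canonical_generators_def by auto

lemma canon_iff:
  "t \<in> canon H \<longleftrightarrow> t \<in> T \<inter> H \<and> {r \<in> T. len (r \<otimes> t) < len t} \<inter> H = {t}"
  unfolding canonical_generators_def by auto

text \<open>The root changes sign inside a reduced word of \<open>w\<close>, so \<open>r\<close>
  conjugates a letter by a proper prefix, and \<open>r \<otimes> w\<close> is shorter than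
  \<open>w\<close>. For a palindromic conjugate the bound is its length.\<close>

lemma shorter_conjugate:
  assumes r: "has_root r \<rho> h" "nonneg \<rho>" "nonpos (\<lambda>x. \<rho> (action w x))"
    and w: "w \<in> carrier G" "s \<in> S"
  shows "len r < 2 * len w + 1" "len (r \<otimes> (w \<otimes> s \<otimes> inv w) \<otimes> r) < 2 * len w + 1"
proof -
  note rT = has_root_reflection[OF r(1)]
  note rc = reflection_closed[OF rT] and sc = S_carrier[OF w(2)]
  obtain ss where ss: "set ss \<subseteq> S" "word ss = w" "length ss = len w"
    using reduced_word w(1) by blast
  obtain xs u ys where x: "ss = xs @ u # ys" "r = word xs \<otimes> u \<otimes> inv (word xs)"
    using strong_exchange[OF ss(1) r(1,2)] r(3) ss(2) by blast
  have xs: "set xs \<subseteq> S" "u \<in> S" using ss(1) x(1) by auto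
  have "len r \<le> 2 * len (word xs) + 1"
    unfolding x(2) using len_conj_le[OF word_S_closed[OF xs(1)] xs(2)] .
  moreover have "len (word xs) < len w"
    using len_le[OF xs(1)] ss(3) x(1) by simp
  ultimately show "len r < 2 * len w + 1" by simp
  have "r \<otimes> (w \<otimes> s \<otimes> inv w) \<otimes> r = (r \<otimes> w) \<otimes> s \<otimes> inv (r \<otimes> w)"
    using rc w(1) sc reflection_inv[OF rT] by (simp add: inv_mult_group m_assoc)
  then have "len (r \<otimes> (w \<otimes> s \<otimes> inv w) \<otimes> r) \<le> 2 * len (r \<otimes> w) + 1"
    using len_conj_le[of "r \<otimes> w" s] rc w by simp
  moreover have "len (r \<otimes> w) < len w"
    using len_reflection_mult_less_iff[OF r(1,2) w(1)] r(3) by simp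
  ultimately show "len (r \<otimes> (w \<otimes> s \<otimes> inv w) \<otimes> r) < 2 * len w + 1" by simp
qed

text \<open>Some other \<open>r\<close> in \<open>H\<close> shortens \<open>t\<close>. In the
  palindrome \<open>w\<close>, \<open>s\<close>, inverse of \<open>w\<close>, its root cannot change
  sign at the middle letter, as this would give \<open>r = t\<close>. If the root is already
  negative after \<open>w\<close>, \<open>r\<close> itself works; otherwise its mirror image
  does.\<close>

lemma noncanonical_reflection:
  assumes H: "subgroup H G" and t: "t \<in> T \<inter> H" "t \<notin> canon H"
  obtains r where "r \<in> T \<inter> H" "len r < len t" "len (r \<otimes> t \<otimes> r) < len t"
proof -
  obtain w s where w: "w \<in> carrier G" "s \<in> S" "t = w \<otimes> s \<otimes> inv w" "len t = 2 * len w + 1"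
    using reflection_palindrome t(1) by blast
  have tT: "t \<in> T" "t \<in> H" using t(1) by auto
  note tc = reflection_closed[OF tT(1)] and sc = S_carrier[OF w(2)]
  have "t \<in> {r \<in> T. len (r \<otimes> t) < len t} \<inter> H"
    using tT w(4) reflection_square[OF tT(1)] by simp
  then obtain r where r: "r \<in> T" "r \<in> H" "r \<noteq> t" "len (r \<otimes> t) < len t"
    using t canon_iff[of t H] by blast
  note rc = reflection_closed[OF r(1)]
  obtain \<rho> h where \<rho>: "has_root r \<rho> h" "nonneg \<rho>" using reflection_has_root r(1) by blast
  have neg: "nonpos (\<lambda>x. \<rho> (action t x))"
    using len_reflection_mult_less_iff[OF \<rho> tc] r(4) by simp
  show thesis
  proof (cases "nonpos (\<lambda>x. \<rho> (action w x))")
    case True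
    then show ?thesis
      using shorter_conjugate[OF \<rho> True w(1,2)] r w(3,4) by (intro that[of r]) auto
  next
    case False
    note conj = has_root_conj[OF \<rho>(1) w(1)]
    have pos: "nonneg (\<lambda>x. \<rho> (action w x))" using has_root_sign[OF conj] False by blast
    have "\<not> nonpos (\<lambda>x. \<rho> (action w (action s x)))"
    proof
      assume "nonpos (\<lambda>x. \<rho> (action w (action s x)))"
      then have "inv w \<otimes> r \<otimes> w = s"
        using only_simple_root_changes_sign[OF conj w(2) pos] by simp
      then have "t = w \<otimes> (inv w \<otimes> r \<otimes> w) \<otimes> inv w" using w(3) by simp
      also have "\<dots> = r" using w(1) rc by (simp add: m_assoc)
      finally show False using r(3) by simp
    qed
    then have pos_s: "nonneg (\<lambda>x. \<rho> (action w (action s x)))"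
      using has_root_sign[OF has_root_conj[OF conj sc]] by blast
    \<comment> \<open>Conjugation by \<open>t\<close> reflects the palindrome, moving the sign
      change from the second half to the first.\<close>
    define r1 where "r1 = t \<otimes> r \<otimes> t"
    have root1: "has_root r1 (\<lambda>x. - \<rho> (action t x)) (\<lambda>i. - action (inv t) h i)"
      unfolding r1_def
      using has_root_minus[OF has_root_conj[OF \<rho>(1) tc]] reflection_inv[OF tT(1)] by simp
    have nonneg1: "nonneg (\<lambda>x. - \<rho> (action t x))" using neg by simp
    have "t \<otimes> w = w \<otimes> s" unfolding w(3) using w(1) sc by (simp add: m_assoc)
    then have "action t (action w x) = action w (action s x)" for x
      using tc w(1) sc by (metis action_mult)
    then have neg1: "nonpos (\<lambda>x. - \<rho> (action t (action w x)))" using pos_s by simp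
    have "r1 \<in> H" using subgroup.m_closed[OF H] r(2) tT(2) by (simp add: r1_def)
    then show ?thesis
      using shorter_conjugate[OF root1 nonneg1 neg1 w(1,2)] has_root_reflection[OF root1] w(3,4)
      by (intro that[of r1]) auto
  qed
qed

lemma canon_closed: "canon H \<subseteq> carrier G"
  using canon_subset reflection_closed by blast

text \<open>Induction on length: \<open>r\<close> and \<open>r \<otimes> t \<otimes> r\<close> are
  both shorter than \<open>t\<close>, so \<open>r\<close> lies in the generated subgroup and
  conjugates the latter back to \<open>t\<close>.\<close>

lemma reflection_conj_canon:
  assumes H: "subgroup H G" and "t \<in> T \<inter> H"
  obtains g a where "g \<in> generate G (canon H)" "a \<in> canon H" "t = g \<otimes> a \<otimes> inv g"
proof -
  have "\<exists>g\<in>generate G (canon H). \<exists>a\<in>canon H. t = g \<otimes> a \<otimes> inv g"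
    using assms(2)
  proof (induction "len t" arbitrary: t rule: less_induct)
    case less
    have tc: "t \<in> carrier G" using less.prems reflection_closed by blast
    show ?case
    proof (cases "t \<in> canon H")
      case True
      then show ?thesis
        using tc generate.one[of G "canon H"] by (intro bexI[of _ \<one>] bexI[of _ t]) auto
    next
      case False
      obtain r where r: "r \<in> T \<inter> H" "len r < len t" "len (r \<otimes> t \<otimes> r) < len t"
        using noncanonical_reflection[OF H less.prems False] .
      have rT: "r \<in> T" and rc: "r \<in> carrier G" using r(1) reflection_closed by blast+
      note rr = reflection_inv[OF rT] reflection_square[OF rT]
      have "r \<otimes> t \<otimes> r \<in> T \<inter> H"
        using reflection_conj[of t r] less.prems rc rr subgroup.m_closed[OF H] r(1) by auto
      from less.hyps[OF r(3) this] obtain g a where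
        g: "g \<in> generate G (canon H)" "a \<in> canon H" "r \<otimes> t \<otimes> r = g \<otimes> a \<otimes> inv g" by blast
      from less.hyps[OF r(2) r(1)] obtain g' a' where
        g': "g' \<in> generate G (canon H)" "a' \<in> canon H" "r = g' \<otimes> a' \<otimes> inv g'" by blast
      have rgen: "r \<in> generate G (canon H)"
        unfolding g'(3) using g' generate_m_inv_closed[OF canon_closed]
        by (intro generate.eng) (auto intro: generate.incl)
      have gc: "g \<in> carrier G" "a \<in> carrier G"
        using g(1,2) generate_in_carrier[OF canon_closed] canon_closed by auto
      have "t = r \<otimes> (r \<otimes> t \<otimes> r) \<otimes> r"
      proof -
        have "r \<otimes> (r \<otimes> t \<otimes> r) \<otimes> r = (r \<otimes> r) \<otimes> t \<otimes> (r \<otimes> r)" using rc tc by (simp add: m_assoc)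
        then show ?thesis using rr tc by simp
      qed
      also have "\<dots> = (r \<otimes> g) \<otimes> a \<otimes> inv (r \<otimes> g)"
        unfolding g(3) using rc gc rr by (simp add: inv_mult_group m_assoc)
      finally show ?thesis
        using generate.eng[OF rgen g(1)] g(2) by blast
    qed
  qed
  then show ?thesis using that by blast
qed

lemma reflection_subgroup_subgroup:
  assumes "reflection_subgroup G S H" shows "subgroup H G"
proof -
  obtain A where "A \<subseteq> T" "H = generate G A" using assms unfolding reflection_subgroup_def by blast
  then show ?thesis using generate_is_subgroup[of A] reflection_closed by blast
qed

text \<open>Within \<open>H\<close> a canonical generator acts like a simple reflection: the only
  reflection whose positive root it makes negative is itself.\<close>

lemma canon_preserves_nonneg:
  assumes a: "a \<in> canon H" and r: "has_root r \<phi> h" "nonneg \<phi>" "r \<in> H" "r \<noteq> a"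
  shows "nonneg (\<lambda>x. \<phi> (action a x))"
proof -
  have aT: "a \<in> T" using a canon_subset by blast
  note ac = reflection_closed[OF aT]
  have "\<not> len (r \<otimes> a) < len a"
    using a r has_root_reflection[OF r(1)] unfolding canon_iff by blast
  then have "\<not> nonpos (\<lambda>x. \<phi> (action a x))"
    using len_reflection_mult_less_iff[OF r(1,2) ac] by simp
  then show ?thesis using has_root_sign[OF has_root_conj[OF r(1) ac]] by blast
qed

text \<open>For \<open>c > 0\<close>, the positive roots \<open>\<alpha> - c * \<beta>\<close> and
  \<open>\<beta> - c * \<alpha>\<close> clash: \<open>a\<close> carries the first to
  \<open>- \<alpha> - c * (\<beta> - c * \<alpha>)\<close>, which is nonpositive, although
  \<open>a\<close> makes only its own root negative.\<close>

lemma canon_obtuse: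
  assumes H: "subgroup H G" and ab: "a \<in> canon H" "b \<in> canon H" "a \<noteq> b"
    and \<alpha>: "has_root a \<alpha> ha" "nonneg \<alpha>" and \<beta>: "has_root b \<beta> hb" "nonneg \<beta>"
  shows "\<alpha> hb \<le> 0"
proof (rule ccontr)
  define c where "c = \<alpha> hb"
  assume "\<not> ?thesis"
  then have c: "c > 0" by (simp add: c_def)
  have c': "\<beta> ha = c" using has_root_sym[OF \<alpha>(1) \<beta>(1)] by (simp add: c_def)
  have mem: "a \<in> H" "b \<in> H" and bT: "b \<in> T" and carr: "a \<in> carrier G" "b \<in> carrier G"
    using ab canon_subset reflection_closed by blast+
  note lin = has_root_linear[OF \<alpha>(1)] has_root_linear[OF \<beta>(1)]
  have act: "\<alpha> (action a x) = - \<alpha> x" "\<alpha> (action b x) = \<alpha> x - c * \<beta> x"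
    "\<beta> (action a x) = \<beta> x - c * \<alpha> x" for x
    using linear_action_reflection[OF lin(1) \<beta>(1)] linear_action_reflection[OF lin(2) \<alpha>(1)]
      has_root_action_self[OF \<alpha>(1)] by (simp_all add: c_def[symmetric] c' mult.commute)
  have pos1: "nonneg (\<lambda>x. \<alpha> x - c * \<beta> x)"
    using canon_preserves_nonneg[OF ab(2) \<alpha> mem(1) ab(3)] by (simp add: act)
  have pos2: "nonneg (\<lambda>x. \<beta> x - c * \<alpha> x)"
    using canon_preserves_nonneg[OF ab(1) \<beta> mem(2) ab(3)[symmetric]] by (simp add: act)
  define \<phi> where "\<phi> = (\<lambda>x. \<alpha> x - c * \<beta> x)"
  obtain h where \<phi>: "has_root (b \<otimes> a \<otimes> b) \<phi> h"
    using has_root_conj[OF \<alpha>(1) carr(2)] reflection_inv[OF bT] by (auto simp: act \<phi>_def)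
  show False
  proof (cases "b \<otimes> a \<otimes> b = a")
    \<comment> \<open>Now \<phi> is a root of \<open>a\<close> and so proportional to \<alpha>;
      evaluation at \<open>hb\<close> shows that it is the negative one.\<close>
    case True
    have eq: "2 * \<alpha> x = \<phi> x * \<alpha> h" for x
      using linear_action_reflection[OF lin(1) \<phi>, of x] act(1)[of x] unfolding True by simp
    define d where "d = \<alpha> h"
    have "\<beta> hb = 2" using has_root_self[OF \<beta>(1)] .
    then have "2 * c = - c * d" using eq[of hb] by (simp add: \<phi>_def d_def c_def)
    then have "c * (d + 2) = 0" by (simp add: algebra_simps)
    then have "d = -2" using c by simp
    then have neg: "\<alpha> x = - \<phi> x" for x using eq[of x] by (simp add: d_def)
    have "nonneg \<phi>" using pos1 by (simp add: \<phi>_def)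
    then have "nonpos \<alpha>" by (simp add: nonneg_def nonpos_def neg)
    then show False using has_root_not_both \<alpha> by blast
  next
    case False
    have inH: "b \<otimes> a \<otimes> b \<in> H" using subgroup.m_closed[OF H] mem by simp
    have "nonneg (\<lambda>x. \<phi> (action a x))"
      using canon_preserves_nonneg[OF ab(1) \<phi> _ inH False] pos1 by (simp add: \<phi>_def)
    moreover have "nonpos (\<lambda>x. \<phi> (action a x))"
      unfolding nonpos_def
    proof (intro allI impI)
      fix x :: "'a + 'a \<Rightarrow> real" assume x: "\<forall>s\<in>S. x (Inl s) \<ge> 0"
      have "\<alpha> x \<ge> 0" "c * \<beta> x \<le> \<alpha> x" "c * \<alpha> x \<le> \<beta> x"
        using \<alpha>(2) pos1 pos2 x by (auto simp: nonneg_def)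
      moreover have "c * (c * \<alpha> x) \<le> c * \<beta> x" "0 \<le> c * \<alpha> x"
        using calculation c by (auto intro: mult_left_mono)
      ultimately show "\<phi> (action a x) \<le> 0"
        by (simp add: \<phi>_def act algebra_simps)
    qed
    ultimately show False using has_root_not_both[OF has_root_conj[OF \<phi> carr(1)]] by blast
  qed
qed

text \<open>Take \<open>p > 0\<close>. If \<open>q\<close> and \<open>r\<close> were both
  nonnegative, \<alpha> would be nonpositive; if both were nonpositive, evaluating the relation at
  \<open>ha\<close> would give at least \<open>2 * p\<close>.\<close>

lemma obtuse_relation_signs:
  assumes \<alpha>: "has_root a \<alpha> ha" "nonneg \<alpha>" and pos: "nonneg \<beta>" "nonneg \<gamma>"
    and obt: "\<beta> ha \<le> 0" "\<gamma> ha \<le> 0"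
    and rel: "\<And>x. p * \<alpha> x + q * \<beta> x + r * \<gamma> x = 0" and p: "p \<noteq> 0"
  shows "q * r < 0"
proof -
  have *: "q' * r' < 0" if rel': "\<And>x. p' * \<alpha> x + q' * \<beta> x + r' * \<gamma> x = 0" and p': "p' > 0" for p' q' r'
  proof (rule ccontr)
    assume "\<not> q' * r' < 0"
    then consider "q' \<ge> 0" "r' \<ge> 0" | "q' \<le> 0" "r' \<le> 0"
      by (metis linear mult_less_0_iff not_less)
    then show False
    proof cases
      case 1
      have "nonpos \<alpha>"
        unfolding nonpos_def
      proof (intro allI impI)
        fix x :: "'a + 'a \<Rightarrow> real" assume "\<forall>s\<in>S. x (Inl s) \<ge> 0"
        then have "\<beta> x \<ge> 0" "\<gamma> x \<ge> 0" using pos by (auto simp: nonneg_def)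
        then have "q' * \<beta> x \<ge> 0" "r' * \<gamma> x \<ge> 0" using 1 by simp_all
        then have "p' * \<alpha> x \<le> 0" using rel'[of x] by linarith
        then show "\<alpha> x \<le> 0" using p' by (simp add: mult_le_0_iff)
      qed
      then show False using has_root_not_both \<alpha> by blast
    next
      case 2
      have "q' * \<beta> ha \<ge> 0" "r' * \<gamma> ha \<ge> 0" using 2 obt by (auto simp: zero_le_mult_iff)
      then show False using rel'[of ha] p' has_root_self[OF \<alpha>(1)] by simp
    qed
  qed
  show ?thesis
  proof (cases "p > 0")
    case True
    then show ?thesis using * rel by blast
  next
    case False
    have "- p * \<alpha> x + - q * \<beta> x + - r * \<gamma> x = 0" for x using rel[of x] by simp
    then show ?thesis using *[of "-p" "-q" "-r"] False p by simp
  qed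
qed

text \<open>In a relation among the three positive roots, each nonzero coefficient forces the other
  two to have opposite signs, which three signs cannot satisfy. The roots would thus be
  independent.\<close>

lemma no_three_canonical_in_plane:
  assumes H: "subgroup H G"
    and mem: "a \<in> canon H" "b \<in> canon H" "c \<in> canon H" and dist: "a \<noteq> b" "b \<noteq> c" "a \<noteq> c"
    and plane: "\<And>r \<rho> h. r \<in> canon H \<Longrightarrow> has_root r \<rho> h \<Longrightarrow> \<exists>p q. \<forall>x. \<rho> x = p * \<sigma> x + q * \<tau> x"
  shows False
proof -
  have T: "a \<in> T" "b \<in> T" "c \<in> T" using mem canon_subset by blast+
  obtain \<alpha> ha where \<alpha>: "has_root a \<alpha> ha" "nonneg \<alpha>" using reflection_has_root T(1) .
  obtain \<beta> hb where \<beta>: "has_root b \<beta> hb" "nonneg \<beta>" using reflection_has_root T(2) .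
  obtain \<gamma> hc where \<gamma>: "has_root c \<gamma> hc" "nonneg \<gamma>" using reflection_has_root T(3) .
  obtain p1 q1 where 1: "\<And>x. \<alpha> x = p1 * \<sigma> x + q1 * \<tau> x" using plane[OF mem(1) \<alpha>(1)] by blast
  obtain p2 q2 where 2: "\<And>x. \<beta> x = p2 * \<sigma> x + q2 * \<tau> x" using plane[OF mem(2) \<beta>(1)] by blast
  obtain p3 q3 where 3: "\<And>x. \<gamma> x = p3 * \<sigma> x + q3 * \<tau> x" using plane[OF mem(3) \<gamma>(1)] by blast
  have no_relation: "p = 0 \<and> q = 0 \<and> r = 0" if rel: "\<And>x. p * \<alpha> x + q * \<beta> x + r * \<gamma> x = 0" for p q r
  proof -
    note obt = canon_obtuse[OF H]
    have ob: "\<beta> ha \<le> 0" "\<gamma> ha \<le> 0" "\<alpha> hb \<le> 0" "\<gamma> hb \<le> 0" "\<alpha> hc \<le> 0" "\<beta> hc \<le> 0"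
      using obt[OF mem(2,1) _ \<beta> \<alpha>] obt[OF mem(3,1) _ \<gamma> \<alpha>] obt[OF mem(1,2) _ \<alpha> \<beta>]
        obt[OF mem(3,2) _ \<gamma> \<beta>] obt[OF mem(1,3) _ \<alpha> \<gamma>] obt[OF mem(2,3) _ \<beta> \<gamma>] dist by auto
    have rel2: "q * \<beta> x + p * \<alpha> x + r * \<gamma> x = 0" "r * \<gamma> x + p * \<alpha> x + q * \<beta> x = 0" for x
      using rel[of x] by simp_all
    have s: "p \<noteq> 0 \<Longrightarrow> q * r < 0" "q \<noteq> 0 \<Longrightarrow> p * r < 0" "r \<noteq> 0 \<Longrightarrow> p * q < 0"
      using obtuse_relation_signs[OF \<alpha> \<beta>(2) \<gamma>(2) ob(1,2) rel]
        obtuse_relation_signs[OF \<beta> \<alpha>(2) \<gamma>(2) ob(3,4) rel2(1)]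
        obtuse_relation_signs[OF \<gamma> \<alpha>(2) \<beta>(2) ob(5,6) rel2(2)] by auto
    show ?thesis
      using s by (smt (verit) mult_less_0_iff)
  qed
  \<comment> \<open>The coefficients are the 2 by 2 minors of the coordinates, which give a relation
    for any three vectors in a plane.\<close>
  have "p1 * q2 - p2 * q1 = 0"
    using no_relation[of "p2 * q3 - p3 * q2" "p3 * q1 - p1 * q3" "p1 * q2 - p2 * q1"]
    by (simp add: 1 2 3 algebra_simps)
  then have det: "p1 * q2 = p2 * q1" by simp
  have "q2 = 0" using no_relation[of q2 "- q1" 0] det by (simp add: 1 2 algebra_simps)
  moreover have "p2 = 0" using no_relation[of p2 "- p1" 0] det by (simp add: 1 2 algebra_simps)
  ultimately have "\<beta> hb = 0" by (simp add: 2)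
  then show False using has_root_self[OF \<beta>(1)] by simp
qed

end

section \<open>Maximal dihedral reflection subgroups\<close>

lemma (in group) involution_conj_int_pow:
  assumes a: "a \<in> carrier G" "a \<otimes> a = \<one>" and x: "x \<in> carrier G" "a \<otimes> x \<otimes> a = inv x"
  shows "a \<otimes> x [^] (i::int) = x [^] (- i) \<otimes> a"
proof (induction i rule: int_induct[where k = 0])
  case base
  show ?case using a by simp
next
  case (step1 i)
  have ax: "a \<otimes> x = inv x \<otimes> a"
  proof -
    have "(a \<otimes> x \<otimes> a) \<otimes> a = a \<otimes> x" using a x(1) by (simp add: m_assoc)
    then show ?thesis using x(2) by simp
  qed
  have "a \<otimes> x [^] (i + 1) = (a \<otimes> x [^] i) \<otimes> x"
    using a x(1) by (simp add: int_pow_mult m_assoc)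
  also have "\<dots> = x [^] (- i) \<otimes> (a \<otimes> x)" using a x(1) step1 by (simp add: m_assoc)
  also have "\<dots> = x [^] (- i) \<otimes> inv x \<otimes> a" using a x(1) ax by (simp add: m_assoc)
  also have "x [^] (- i) \<otimes> inv x = x [^] (- (i + 1))"
    using x(1) int_pow_mult[of x "- i" "- 1"] by (simp add: int_pow_neg)
  finally show ?case .
next
  case (step2 i)
  have ax: "a \<otimes> inv x = x \<otimes> a"
  proof -
    have "a \<otimes> inv x = (a \<otimes> a) \<otimes> x \<otimes> a" using a(1) x by (simp add: m_assoc flip: x(2))
    then show ?thesis using a x(1) by simp
  qed
  have "a \<otimes> x [^] (i - 1) = (a \<otimes> x [^] i) \<otimes> inv x"
    using a x(1) int_pow_mult[of x i "- 1"] by (simp add: m_assoc int_pow_neg)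
  also have "\<dots> = x [^] (- i) \<otimes> (a \<otimes> inv x)" using a x(1) step2 by (simp add: m_assoc)
  also have "\<dots> = x [^] (- i) \<otimes> x \<otimes> a" using a x(1) ax by (simp add: m_assoc)
  also have "x [^] (- i) \<otimes> x = x [^] (- (i - 1))"
    using x(1) int_pow_mult[of x "- i" 1] by simp
  finally show ?case .
qed

section \<open>Dihedral subgroups inside the divisor subgroup\<close>

context coxeter_matrix_system
begin

lemma reflection_divisorI:
  assumes "r \<in> T" "r \<otimes> w \<in> T" "w \<in> carrier G"
  shows "r \<in> reflection_divisors G S w"
proof -
  have "w = r \<otimes> (r \<otimes> w)"
    using assms reflection_closed[OF assms(1)] reflection_square[OF assms(1)]
    by (simp add: m_assoc[symmetric])
  then show ?thesis using assms unfolding reflection_divisors_def by blast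
qed

text \<open>\<open>D\<close> is the set of reflections of the group generated by \<open>a\<close>
  and \<open>b\<close>: it is closed under products of three, contains the reflections in
  \<open>K\<close> and consists of reflections of the whole group.\<close>

lemma dihedral_reflection_divisors:
  assumes a: "a \<in> T" and b: "b \<in> T" and K: "K \<inter> T \<subseteq> {g \<otimes> c \<otimes> inv g | g c. g \<in> generate G {a, b} \<and> c \<in> {a, b}}"
    and t: "t \<in> K \<inter> T" and t': "t' \<in> K \<inter> T"
  shows "K \<inter> T \<subseteq> reflection_divisors G S (t \<otimes> t')"
proof -
  define x where "x = a \<otimes> b"
  define D where "D = {x [^] (i::int) \<otimes> a | i. True}"
  note ac = reflection_closed[OF a] and bc = reflection_closed[OF b]
  note aa = reflection_square[OF a] and bb = reflection_square[OF b]
  note ai = reflection_inv[OF a] and bi = reflection_inv[OF b]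
  have xc: "x \<in> carrier G" using ac bc by (simp add: x_def)
  have axa: "a \<otimes> x \<otimes> a = inv x"
  proof -
    have "a \<otimes> x \<otimes> a = (a \<otimes> a) \<otimes> b \<otimes> a" using ac bc by (simp add: x_def m_assoc)
    then show ?thesis using aa ac bc ai bi by (simp add: x_def inv_mult_group)
  qed
  note swap = involution_conj_int_pow[OF ac aa xc axa]
  have two: "(x [^] i \<otimes> a) \<otimes> (x [^] j \<otimes> a) = x [^] (i - j)" for i j :: int
  proof -
    have "(x [^] i \<otimes> a) \<otimes> (x [^] j \<otimes> a) = x [^] i \<otimes> (a \<otimes> x [^] j) \<otimes> a"
      using xc ac by (simp add: m_assoc)
    also have "\<dots> = x [^] i \<otimes> x [^] (- j) \<otimes> (a \<otimes> a)"
      unfolding swap using xc ac by (simp add: m_assoc)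
    also have "\<dots> = x [^] (i - j)" using xc aa int_pow_mult[of x i "- j"] by simp
    finally show ?thesis .
  qed
  have three: "u \<otimes> v \<otimes> z \<in> D" if uvz: "u \<in> D" "v \<in> D" "z \<in> D" for u v z
  proof -
    obtain i j k :: int where "u = x [^] i \<otimes> a" "v = x [^] j \<otimes> a" "z = x [^] k \<otimes> a"
      using uvz unfolding D_def by blast
    then have "u \<otimes> v \<otimes> z = x [^] (i - j) \<otimes> (x [^] k \<otimes> a)" using two by simp
    also have "\<dots> = x [^] (i - j + k) \<otimes> a" using xc ac by (simp add: int_pow_mult m_assoc)
    finally show ?thesis unfolding D_def by blast
  qed
  have b_eq: "b = x [^] (- 1 :: int) \<otimes> a"
  proof -
    have "b \<otimes> a \<otimes> a = b" using aa ac bc by (simp add: m_assoc)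
    then show ?thesis using ac bc ai bi xc by (simp add: x_def int_pow_neg inv_mult_group)
  qed
  have aD: "a \<in> D" unfolding D_def using ac by (auto intro: exI[of _ 0])
  have bD: "b \<in> D" unfolding D_def using b_eq by blast
  have gen: "g \<in> carrier G \<and> (\<forall>d\<in>D. g \<otimes> d \<otimes> inv g \<in> D)" if "g \<in> generate G {a, b}" for g
    using that
  proof (induction rule: generate.induct)
    case one
    then show ?case using xc ac by (auto simp: D_def)
  next
    case (incl h)
    then show ?case using three aD bD ac bc ai bi by auto
  next
    case (inv h)
    then show ?case using three aD bD ac bc ai bi by auto
  next
    case (eng h1 h2)
    have "h1 \<otimes> h2 \<otimes> d \<otimes> inv (h1 \<otimes> h2) = h1 \<otimes> (h2 \<otimes> d \<otimes> inv h2) \<otimes> inv h1" if "d \<in> D" for d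
      using that eng xc ac by (auto simp: D_def inv_mult_group m_assoc)
    then show ?case using eng by simp
  qed
  have KD: "K \<inter> T \<subseteq> D" using K gen aD bD by blast
  have DT: "D \<subseteq> T"
  proof
    fix d assume "d \<in> D"
    then obtain i :: int where i: "d = x [^] i \<otimes> a" unfolding D_def by blast
    \<comment> \<open>Conjugation by a power of \<open>x\<close> shifts the exponent by an even
      number, so parity decides between conjugates of \<open>a\<close> and of
      \<open>b\<close>.\<close>
    have conj: "x [^] j \<otimes> (x [^] k \<otimes> a) \<otimes> inv (x [^] j) = x [^] (2 * j + k) \<otimes> a" for j k :: int
    proof -
      have "x [^] j \<otimes> (x [^] k \<otimes> a) \<otimes> inv (x [^] j) = x [^] j \<otimes> x [^] k \<otimes> (a \<otimes> x [^] (- j))"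
        using xc ac by (simp add: int_pow_neg m_assoc)
      also have "\<dots> = x [^] j \<otimes> x [^] k \<otimes> x [^] j \<otimes> a"
        unfolding swap using xc ac by (simp add: m_assoc)
      also have "x [^] j \<otimes> x [^] k \<otimes> x [^] j = x [^] (2 * j + k)"
        using xc by (simp add: int_pow_mult[symmetric])
      finally show ?thesis .
    qed
    show "d \<in> T"
    proof (cases "even i")
      case True
      then obtain j where "i = 2 * j" by (rule evenE)
      then have "d = x [^] j \<otimes> a \<otimes> inv (x [^] j)" using conj[of j 0] i xc ac by simp
      then show ?thesis using reflection_conj[OF a] xc by simp
    next
      case False
      then obtain j where "i = 2 * j + 1" by (rule oddE)
      \<comment> \<open>\<open>b\<close> has exponent -1, hence the shift from \<open>j\<close> to
        \<open>j + 1\<close>.\<close>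
      then have "i = 2 * (j + 1) + - 1" by simp
      then have "d = x [^] (j + 1) \<otimes> b \<otimes> inv (x [^] (j + 1))"
        using conj[of "j + 1" "- 1"] i b_eq by simp
      then show ?thesis using reflection_conj[OF b] xc by simp
    qed
  qed
  show ?thesis
  proof
    fix r assume r: "r \<in> K \<inter> T"
    have c: "r \<in> carrier G" "t \<in> carrier G" "t' \<in> carrier G"
      using r t t' reflection_closed by auto
    have "r \<otimes> t \<otimes> t' \<in> T" using three[of r t t'] r t t' KD DT by blast
    then have "r \<otimes> (t \<otimes> t') \<in> T" using c by (simp add: m_assoc)
    then show "r \<in> reflection_divisors G S (t \<otimes> t')"
      using r c by (intro reflection_divisorI) auto
  qed
qed

lemma dihedral_subset_divisor_subgroup:
  assumes K: "dihedral_reflection_subgroup G S K" and t: "t \<in> K" "t \<in> T" "t' \<in> K" "t' \<in> T"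
  shows "K \<subseteq> divisor_subgroup G S (t \<otimes> t')"
proof -
  have refl: "reflection_subgroup G S K" and "card (canon K) = 2"
    using K unfolding dihedral_reflection_subgroup_def by auto
  then obtain a b where ab: "canon K = {a, b}" by (meson card_2_iff)
  note sub = reflection_subgroup_subgroup[OF refl]
  have abT: "a \<in> T" "b \<in> T" using ab canon_subset by blast+
  have "K \<inter> T \<subseteq> {g \<otimes> c \<otimes> inv g | g c. g \<in> generate G {a, b} \<and> c \<in> {a, b}}"
  proof
    fix r assume "r \<in> K \<inter> T"
    then obtain g c where "g \<in> generate G (canon K)" "c \<in> canon K" "r = g \<otimes> c \<otimes> inv g"
      using reflection_conj_canon[OF sub, of r] by blast
    then show "r \<in> {g \<otimes> c \<otimes> inv g | g c. g \<in> generate G {a, b} \<and> c \<in> {a, b}}"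
      unfolding ab by blast
  qed
  from dihedral_reflection_divisors[OF abT this] have
    "K \<inter> T \<subseteq> reflection_divisors G S (t \<otimes> t')" using t by blast
  moreover obtain A where A: "A \<subseteq> T" "K = generate G A"
    using refl unfolding reflection_subgroup_def by blast
  moreover have "A \<subseteq> K" unfolding A(2) by (auto intro: generate.incl)
  ultimately show ?thesis
    unfolding divisor_subgroup_def using mono_generate[of A] by blast
qed

section \<open>The rank of the divisor subgroup\<close>

lemma reflection_divisors_subset: "reflection_divisors G S w \<subseteq> T"
  unfolding reflection_divisors_def by blast

lemma divisor_subgroup_reflection_subgroup: "reflection_subgroup G S (divisor_subgroup G S w)"
  unfolding reflection_subgroup_def divisor_subgroup_def using reflection_divisors_subset by blast

text \<open>A vector fixed by \<open>w = r r'\<close> is annihilated by the roots of \<open>r\<close> and \<open>r'\<close> because their coroots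
  are linearly independent.\<close>

lemma reflection_divisor_root:
  assumes t: "has_root t \<sigma> hs" and t': "has_root t' \<tau> ht" and "t \<noteq> t'"
    and r: "r \<in> reflection_divisors G S (t \<otimes> t')" "has_root r \<rho> h"
  obtains p q where "\<And>x. \<rho> x = p * \<sigma> x + q * \<tau> x"
proof -
  obtain r' where r': "r' \<in> T" "t \<otimes> t' = r \<otimes> r'"
    using r(1) unfolding reflection_divisors_def by blast
  obtain \<rho>' h' where \<rho>': "has_root r' \<rho>' h'" using reflection_has_root r'(1) by blast
  note T = has_root_reflection[OF t] has_root_reflection[OF t'] has_root_reflection[OF r(2)]
  note carr = reflection_closed[OF T(1)] reflection_closed[OF T(2)] reflection_closed[OF T(3)]
    reflection_closed[OF r'(1)]
  have ne: "r \<noteq> r'"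
  proof
    assume "r = r'"
    then have "t \<otimes> t' = \<one>" using r'(2) reflection_square[OF T(3)] by simp
    then have "t = inv t'" using carr by (metis inv_equality)
    then show False using reflection_inv[OF T(2)] assms(3) by simp
  qed
  have "\<rho> x = 0" if x: "\<sigma> x = 0" "\<tau> x = 0" for x
  proof (rule ccontr)
    assume nz: "\<rho> x \<noteq> 0"
    have "action t (action t' x) = x"
      using has_root_action[OF t] has_root_action[OF t'] x by simp
    then have "action r (action r' x) = x" using r'(2) carr by (metis action_mult)
    then have "action r' x = action r x"
      using carr reflection_square[OF T(3)] by (metis action_mult action_one)
    then have eq: "\<rho>' x * h' i = \<rho> x * h i" for i
      unfolding has_root_action[OF r(2)] has_root_action[OF \<rho>'] by (simp add: fun_eq_iff)
    define k where "k = \<rho>' x / \<rho> x"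
    have hk: "h i = k * h' i" for i using eq[of i] nz by (simp add: k_def field_simps)
    obtain w s where w: "w \<in> carrier G" "s \<in> S" "\<rho> = root_form w s" "h = coroot w s"
      using r(2) by (rule has_rootE)
    obtain w' s' where w': "w' \<in> carrier G" "s' \<in> S" "\<rho>' = root_form w' s'" "h' = coroot w' s'"
      using \<rho>' by (rule has_rootE)
    have "\<rho> y = k * \<rho>' y" for y
      unfolding w(3) w'(3)
      by (rule proportional_coroots[OF w(1,2) w'(1,2)]) (use hk w(4) w'(4) in simp)
    then show False using proportional_roots[OF r(2) \<rho>'] ne by blast
  qed
  then show ?thesis
    using linear_functional_span[OF has_root_linear[OF t] has_root_linear[OF t'] has_root_linear[OF r(2)], of hs]
      has_root_self[OF t] that by auto
qed

text \<open>Each generator alters any functional only by elements of the plane of \<sigma> and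
  \<tau>, and this persists in products. A reflection negates its own root, so twice that root lies
  in the plane.\<close>

lemma divisor_subgroup_root:
  assumes t: "has_root t \<sigma> hs" and t': "has_root t' \<tau> ht" and "t \<noteq> t'"
    and r: "r \<in> divisor_subgroup G S (t \<otimes> t')" "has_root r \<rho> h"
  shows "\<exists>p q. \<forall>x. \<rho> x = p * \<sigma> x + q * \<tau> x"
proof -
  let ?R = "reflection_divisors G S (t \<otimes> t')"
  have Rc: "?R \<subseteq> carrier G" using reflection_divisors_subset reflection_closed by blast
  have refl: "\<exists>p q. \<forall>x. \<phi> (action g x) = \<phi> x + p * \<sigma> x + q * \<tau> x"
    if g: "g \<in> ?R" "linear_functional \<phi>" for g \<phi>
  proof -
    have "g \<in> T" using g(1) reflection_divisors_subset by blast
    then obtain \<gamma> k where \<gamma>: "has_root g \<gamma> k" by (rule reflection_has_root)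
    obtain p q where "\<And>x. \<gamma> x = p * \<sigma> x + q * \<tau> x"
      using reflection_divisor_root[OF t t' assms(3) g(1) \<gamma>] by blast
    then have "\<phi> (action g x) = \<phi> x + (- p * \<phi> k) * \<sigma> x + (- q * \<phi> k) * \<tau> x" for x
      using linear_action_reflection[OF g(2) \<gamma>] by (simp add: algebra_simps)
    then show ?thesis by blast
  qed
  have gen: "\<exists>p q. \<forall>x. \<phi> (action g x) = \<phi> x + p * \<sigma> x + q * \<tau> x"
    if "g \<in> generate G ?R" "linear_functional \<phi>" for g \<phi>
    using that
  proof (induction arbitrary: \<phi> rule: generate.induct)
    case one
    then show ?case by (intro exI[of _ 0]) simp
  next
    case (incl g)
    then show ?case using refl by blast
  next
    case (inv g)
    then have "inv g = g" using reflection_inv reflection_divisors_subset by blast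
    then show ?case using inv refl by simp
  next
    case (eng g1 g2)
    have c: "g1 \<in> carrier G" "g2 \<in> carrier G"
      using eng generate_in_carrier[OF Rc] by auto
    obtain p1 q1 where 1: "\<And>x. \<phi> (action g1 x) = \<phi> x + p1 * \<sigma> x + q1 * \<tau> x"
      using eng.IH(1)[OF eng.prems] by blast
    obtain p2 q2 where 2: "\<And>x. \<phi> (action g2 x) = \<phi> x + p2 * \<sigma> x + q2 * \<tau> x"
      using eng.IH(2)[OF eng.prems] by blast
    \<comment> \<open>Composition also needs the claim for \<sigma> and \<tau>, hence the induction
      over all functionals.\<close>
    obtain p3 q3 where 3: "\<And>x. \<sigma> (action g2 x) = \<sigma> x + p3 * \<sigma> x + q3 * \<tau> x"
      using eng.IH(2)[OF has_root_linear[OF t]] by blast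
    obtain p4 q4 where 4: "\<And>x. \<tau> (action g2 x) = \<tau> x + p4 * \<sigma> x + q4 * \<tau> x"
      using eng.IH(2)[OF has_root_linear[OF t']] by blast
    have "\<phi> (action (g1 \<otimes> g2) x) = \<phi> x + (p2 + p1 * (1 + p3) + q1 * p4) * \<sigma> x
        + (q2 + p1 * q3 + q1 * (1 + q4)) * \<tau> x" for x
      using c by (simp add: action_mult 1 2 3 4 algebra_simps)
    then show ?case by blast
  qed
  obtain p q where "\<And>x. \<rho> (action r x) = \<rho> x + p * \<sigma> x + q * \<tau> x"
    using gen[OF _ has_root_linear[OF r(2)]] r(1) unfolding divisor_subgroup_def by blast
  then have "\<rho> x = (- p / 2) * \<sigma> x + (- q / 2) * \<tau> x" for x
    using has_root_action_self[OF r(2), of x] by (simp add: field_simps)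
  then show ?thesis by blast
qed

lemma generate_singleton_conj:
  assumes "a \<in> carrier G" "g \<in> generate G {a}"
  shows "g \<otimes> a \<otimes> inv g = a"
proof -
  obtain i :: int where "g = a [^] i"
    using assms generate_pow[of a] by auto
  then have "g \<otimes> a = a \<otimes> g" "g \<in> carrier G"
    using assms(1) int_pow_mult[of a i 1] int_pow_mult[of a 1 i] by (simp_all add: add.commute)
  then show ?thesis using assms(1) by (simp add: m_assoc)
qed

text \<open>The plane bounds the rank by two, and the distinct reflections \<open>t\<close> and
  \<open>t'\<close> exclude rank one.\<close>

lemma divisor_subgroup_dihedral:
  assumes t: "t \<in> T" and t': "t' \<in> T" and ne: "t \<noteq> t'"
  shows "dihedral_reflection_subgroup G S (divisor_subgroup G S (t \<otimes> t'))"
    and "t \<in> divisor_subgroup G S (t \<otimes> t')" "t' \<in> divisor_subgroup G S (t \<otimes> t')"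
proof -
  define H where "H = divisor_subgroup G S (t \<otimes> t')"
  have refl: "reflection_subgroup G S H"
    unfolding H_def by (rule divisor_subgroup_reflection_subgroup)
  note sub = reflection_subgroup_subgroup[OF refl]
  note carr = reflection_closed[OF t] reflection_closed[OF t']
  have "t \<otimes> (t \<otimes> t') = t'" "t' \<otimes> (t \<otimes> t') = t' \<otimes> t \<otimes> inv t'"
    using carr reflection_square[OF t] reflection_inv[OF t'] by (simp_all add: m_assoc[symmetric])
  then have "t \<in> reflection_divisors G S (t \<otimes> t')" "t' \<in> reflection_divisors G S (t \<otimes> t')"
    using reflection_divisorI[of t "t \<otimes> t'"] reflection_divisorI[of t' "t \<otimes> t'"] t t' carr
      reflection_conj[OF t carr(2)] by auto
  then have mem: "t \<in> H" "t' \<in> H"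
    unfolding H_def divisor_subgroup_def by (auto intro: generate.incl)
  then show "t \<in> divisor_subgroup G S (t \<otimes> t')" "t' \<in> divisor_subgroup G S (t \<otimes> t')"
    by (auto simp: H_def)
  obtain g a where ga: "g \<in> generate G (canon H)" "a \<in> canon H" "t = g \<otimes> a \<otimes> inv g"
    using reflection_conj_canon[OF sub, of t] t mem by blast
  have ac: "a \<in> carrier G" using ga(2) canon_closed by blast
  \<comment> \<open>With a single canonical generator every reflection in \<open>H\<close> would be
    a conjugate of \<open>a\<close> by a power of \<open>a\<close>, hence \<open>a\<close>
    itself.\<close>
  have "canon H \<noteq> {a}"
  proof
    assume one: "canon H = {a}"
    have "r = a" if r: "r \<in> T \<inter> H" for r
    proof -
      obtain k b where kb: "k \<in> generate G (canon H)" "b \<in> canon H" "r = k \<otimes> b \<otimes> inv k"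
        using reflection_conj_canon[OF sub r] .
      then show ?thesis using generate_singleton_conj[OF ac] one by simp
    qed
    then have "t = a" "t' = a" using t t' mem by blast+
    then show False using ne by simp
  qed
  then obtain b where b: "b \<in> canon H" "b \<noteq> a" using ga(2) by blast
  obtain \<sigma> hs where \<sigma>: "has_root t \<sigma> hs" using reflection_has_root t by blast
  obtain \<tau> ht where \<tau>: "has_root t' \<tau> ht" using reflection_has_root t' by blast
  have plane: "\<exists>p q. \<forall>x. \<rho> x = p * \<sigma> x + q * \<tau> x" if "r \<in> canon H" "has_root r \<rho> h" for r \<rho> h
    using divisor_subgroup_root[OF \<sigma> \<tau> ne _ that(2)] that(1) canon_subset[of H]
    unfolding H_def by blast
  have "c = a \<or> c = b" if "c \<in> canon H" for c
    using no_three_canonical_in_plane[OF sub ga(2) b(1) that, of \<sigma> \<tau>] plane b(2) by blast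
  then have "canon H = {a, b}" using ga(2) b(1) by blast
  then have "card (canon H) = 2" using b(2) by simp
  then show "dihedral_reflection_subgroup G S (divisor_subgroup G S (t \<otimes> t'))"
    using refl unfolding dihedral_reflection_subgroup_def H_def by simp
qed

end

theorem theorem1p6:
  fixes G :: "('a, 'b) monoid_scheme" and S :: "'a set" and t t' :: 'a
  assumes "coxeter_system G S"
    and "t \<in> reflections G S" and "t' \<in> reflections G S" and "t \<noteq> t'"
  shows "(\<exists>!H. maximal_dihedral_containing G S t t' H) \<and>
    maximal_dihedral G S t t' = divisor_subgroup G S (t \<otimes>\<^bsub>G\<^esub> t')"
proof -
  interpret coxeter_system G S by fact
  obtain m where "coxeter_matrix S m" "presented_by G S (coxeter_relators S m)"
    using coxeter_presentation by blast
  then interpret coxeter_matrix_system G S m by unfold_locales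
  define H where "H = divisor_subgroup G S (t \<otimes>\<^bsub>G\<^esub> t')"
  note dihedral = divisor_subgroup_dihedral[OF assms(2-4), folded H_def]
  \<comment> \<open>The comparison covers every dihedral subgroup through \<open>t\<close> and
    \<open>t'\<close>, not just those above \<open>H\<close>, and this yields uniqueness.\<close>
  have greatest: "K \<subseteq> H" if "dihedral_reflection_subgroup G S K" "t \<in> K" "t' \<in> K" for K
    using dihedral_subset_divisor_subgroup[OF that(1)] that assms(2,3) unfolding H_def by blast
  have max: "maximal_dihedral_containing G S t t' H"
    using dihedral greatest unfolding maximal_dihedral_containing_def by blast
  have unique: "K = H" if "maximal_dihedral_containing G S t t' K" for K
    using that dihedral greatest unfolding maximal_dihedral_containing_def by blast
  have "maximal_dihedral G S t t' = H"
    unfolding maximal_dihedral_def using max unique by (rule the_equality)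
  then show ?thesis using max unique unfolding H_def by blast
qed

end
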